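(* Let $\lambda>0$. Suppose that for all $R\in[0,1]$ and $v_1,v_2,v_3>0$ $$\Phi(R,v_1,v_2,v_3)\ge \phi(v_1)+\phi(v_2)+\phi(v_3)+h(v_1v_2v_3),$$ where $\phi,h:(0,\infty)\to(0,\infty)$ are strictly convex and such that: (i) $\phi(v)\ge Cv^\gamma$ for all $v>0$, for some constants $C>0$ and $1<\gamma<3$; (ii) $h(d)/d\to\infty$ as $d\to\infty$; (iii) $h(d)\ge Kd^{-s}$ for all $d>0$, for some constants $K>0$ and $s\ge\gamma^*=\frac{\gamma}{\gamma-1}$. Then there exists $r_\lambda\in\mathcal{A}_\lambda$ such that $$I(r_\lambda)=\inf_{r\in\mathcal{A}_\lambda}I(r).$$
   Context: $\Phi:[0,1]\times(0,\infty)^3\to[0,\infty)$, $(R,v_1,v_2,v_3)\mapsto\Phi(R,v_1,v_2,v_3)$, is a stored energy function, symmetric in its last three arguments. The reference mass density $\rho_0:[0,1]\to\mathbb{R}$ satisfies $k_0\le\rho_0(R)\le k_1$ for $0\le R\le 1$, with positive constants $k_0,k_1$, and $M_R=4\pi\int_0^R\rho_0(u)u^2\,du$. Define $$I(r)=I_{\rm mec}(r)-I_{\rm pot}(r),\quad I_{\rm mec}(r)=\int_0^1\Phi\left(R,r'(R),\tfrac{r(R)}{R},\tfrac{r(R)}{R}\right)R^2\,dR,\quad I_{\rm pot}(r)=\int_0^1\rho_0(R)\frac{M_R}{r(R)}R^2\,dR,$$ and $$\mathcal{A}_\lambda=\{r\in W^{1,1}(0,1): r(1)=\lambda,\ r'(R)>0\text{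 for a.e. }R\in(0,1),\ r(0)\ge0,\ I_{\rm mec}(r)<\infty\}.$$ The map $R\mapsto\lambda R$ belongs to $\mathcal{A}_\lambda$, so $\mathcal{A}_\lambda\neq\emptyset$.
   Formalization: The formal theorem additionally assumes that Φ is convex in each of v_1, v_2, v_3 separately (and measurable in R); without convexity the stated lower bound on Φ alone does not guarantee that the infimum is attained. *)

theory Defs
  imports "HOL-Analysis.Analysis"
begin

definition strictly_convex_on :: "real set \<Rightarrow> (real \<Rightarrow> real) \<Rightarrow> bool" where
  "strictly_convex_on S f \<longleftrightarrow> convex S \<and>
     (\<forall>x\<in>S. \<forall>y\<in>S. \<forall>t. x \<noteq> y \<longrightarrow> 0 < t \<longrightarrow> t < 1 \<longrightarrow>
        f ((1 - t) * x + t * y) < (1 - t) * f x + t * f y)"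

(* The space C^1_c(0,1) of test functions. *)
definition test_function :: "(real \<Rightarrow> real) \<Rightarrow> bool" where
  "test_function \<psi> \<longleftrightarrow> (\<forall>x. \<psi> differentiable (at x)) \<and> continuous_on UNIV (deriv \<psi>) \<and>
     (\<exists>a b. 0 < a \<and> b < 1 \<and> (\<forall>x. x \<notin> {a..b} \<longrightarrow> \<psi> x = 0))"

definition has_weak_derivative :: "(real \<Rightarrow> real) \<Rightarrow> (real \<Rightarrow> real) \<Rightarrow> bool" where
  "has_weak_derivative r g \<longleftrightarrow> integrable (lebesgue_on {0<..<1}) g \<and>
     (\<forall>\<psi>. test_function \<psi> \<longrightarrow>
        (LINT x|lebesgue_on {0<..<1}. r x * deriv \<psi> x) =
        - (LINT x|lebesgue_on {0<..<1}. g x * \<psi> x))"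

definition sobolev_W11 :: "(real \<Rightarrow> real) set" where
  "sobolev_W11 = {r. integrable (lebesgue_on {0<..<1}) r \<and> (\<exists>g. has_weak_derivative r g)}"

(* A representative of the weak derivative. It is determined only up to null sets;
   everything below depends on it only almost everywhere. *)
definition weak_deriv :: "(real \<Rightarrow> real) \<Rightarrow> real \<Rightarrow> real" where
  "weak_deriv r = (SOME g. has_weak_derivative r g)"

definition symmetric_in_stretches :: "(real \<Rightarrow> real \<Rightarrow> real \<Rightarrow> real \<Rightarrow> real) \<Rightarrow> bool" where
  "symmetric_in_stretches \<Phi> \<longleftrightarrow>
     (\<forall>R\<in>{0..1}. \<forall>v1>0. \<forall>v2>0. \<forall>v3>0.
        \<Phi> R v1 v2 v3 = \<Phi> R v2 v1 v3 \<and> \<Phi> R v1 v2 v3 = \<Phi> R v1 v3 v2)"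

definition mass_within :: "(real \<Rightarrow> real) \<Rightarrow> real \<Rightarrow> real" where
  "mass_within \<rho>0 R = 4 * pi * (LINT u|lebesgue_on {0..R}. \<rho>0 u * u\<^sup>2)"

definition I_mec :: "(real \<Rightarrow> real \<Rightarrow> real \<Rightarrow> real \<Rightarrow> real) \<Rightarrow> (real \<Rightarrow> real) \<Rightarrow> ennreal" where
  "I_mec \<Phi> r =
     (\<integral>\<^sup>+R. ennreal (\<Phi> R (weak_deriv r R) (r R / R) (r R / R) * R\<^sup>2) \<partial>lebesgue_on {0<..<1})"

definition I_pot :: "(real \<Rightarrow> real) \<Rightarrow> (real \<Rightarrow> real) \<Rightarrow> ennreal" where
  "I_pot \<rho>0 r =
     (\<integral>\<^sup>+R. ennreal (\<rho>0 R * (mass_within \<rho>0 R / r R) * R\<^sup>2) \<partial>lebesgue_on {0<..<1})"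

(* On the admissible class the first term is finite, so the difference never has the
   form infinity - infinity. *)
definition I_total ::
  "(real \<Rightarrow> real \<Rightarrow> real \<Rightarrow> real \<Rightarrow> real) \<Rightarrow> (real \<Rightarrow> real) \<Rightarrow> (real \<Rightarrow> real) \<Rightarrow> ereal" where
  "I_total \<Phi> \<rho>0 r = enn2ereal (I_mec \<Phi> r) - enn2ereal (I_pot \<rho>0 r)"

(* An element of W^{1,1}(0,1) is represented by its continuous representative on [0,1],
   which gives r 0 and r 1 their meaning. *)
definition admissible :: "(real \<Rightarrow> real \<Rightarrow> real \<Rightarrow> real \<Rightarrow> real) \<Rightarrow> real \<Rightarrow> (real \<Rightarrow> real) set" where
  "admissible \<Phi> l =
     {r \<in> sobolev_W11. continuous_on {0..1} r \<and> r 1 = l \<and>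
        (AE R in lebesgue_on {0<..<1}. weak_deriv r R > 0) \<and>
        r 0 \<ge> 0 \<and> I_mec \<Phi> r < \<infinity>}"

(* Convexity in each principal stretch, stated for the first one only because it is used
   together with symmetry. Polyconvex and rank-one convex isotropic energies have this
   property. Together with finiteness and symmetry it makes the energy continuous in the
   stretches. *)
definition stretch_convex :: "(real \<Rightarrow> real \<Rightarrow> real \<Rightarrow> real \<Rightarrow> real) \<Rightarrow> bool" where
  "stretch_convex \<Phi> \<longleftrightarrow>
     (\<forall>R\<in>{0..1}. \<forall>v2>0. \<forall>v3>0. convex_on {0<..} (\<lambda>v1. \<Phi> R v1 v2 v3))"

end

theory Submission
  imports Defs "HOL-Probability.Probability"
begin

text \<open>
  Young's inequality applied to \<open>\<phi>(r') + h(r' (r/R)\<^sup>2)\<close> bounds \<open>(R/r)\<^sup>2\<close> by the stored energy.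
  This absorbs the gravitational integrand into half of the mechanical one, so that the total
  integrand plus a constant is a nonnegative function \<open>F(R, r', r/R)\<close>, convex in \<open>r'\<close>, and the
  mechanical energy is bounded along a minimizing sequence \<open>r\<^sub>j\<close>. The \<open>r\<^sub>j\<close> are increasing and
  bounded, hence a subsequence converges almost everywhere (Helly). No weak compactness in
  \<open>L\<^sup>1\<close> is needed: among the convex combinations of the tails of \<open>(r\<^sub>j')\<close> those that nearly minimize
  the entropy \<open>\<integral> v ln v R\<^sup>2 dR\<close>, which the growth of \<open>\<phi>\<close> keeps bounded, form a Cauchy sequence in
  \<open>L\<^sup>1(R\<^sup>2 dR)\<close>, hence converge almost everywhere along a subsequence to some \<open>G\<close>. Convexity in the
  slope and continuity in \<open>r/R\<close> give, pointwise almost everywhere, a lower bound for the same convex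
  combinations of \<open>F(R, r\<^sub>j', r\<^sub>j/R)\<close> by \<open>F(R, G, r/R)\<close>, and Fatou's lemma finishes the proof. The
  singularity of \<open>h\<close> at zero forces \<open>G > 0\<close>.
\<close>

section \<open>Weak derivatives and primitives\<close>

text \<open>The weight R^2 degenerates at the center, so the energy controls slopes only in L^1(R^2
  dR): part of the mass of r_j' may concentrate at 0 and be lost in the limit, which then has r(0) >
  0 (cavitation). Deformations are therefore recovered by integrating the slope from the outer
  boundary, where r is prescribed; primitives over [x, 1] with x > 0 pass to the limit, and the
  constraint at 0 survives as an inequality. The second obstacle is that convexity in r' holds only
  for frozen r/R. Slopes and energies are averaged with the same weights while r_j/R converges
  without averaging, so the functions being averaged vary with j; they are compared through secants,
  whose slopes converge with the functions. The entropy is chosen because its midpoint deficit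
  controls |a - b| quantitatively, whereas it grows more slowly than every power above the first.
  Conjugacy of gamma and gamma/(gamma-1) is what Young's inequality needs for 1/w^2 = v * (1/(v
  w^2)), with slope v and w = r/R.\<close>

abbreviation unit_leb :: "real measure" where
  "unit_leb \<equiv> lebesgue_on {0<..<1}"

text \<open>Total on the real line: constant to the left of 0 and zero to the right of 1, which
  suits theorems about monotone functions on the whole line.\<close>

definition tail :: "(real \<Rightarrow> real) \<Rightarrow> real \<Rightarrow> real" where
  "tail g x = (LINT y|unit_leb. indicator {x..} y * g y)"

section \<open>Lebesgue measure on the open unit interval\<close>

lemma finite_unit_leb: "finite_measure unit_leb"
  by (rule finite_measure_lebesgue_on) auto

lemma continuous_measurable_unit_leb:
  fixes f :: "real \<Rightarrow> real"
  assumes "continuous_on {0<..<1} f"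
  shows "f \<in> borel_measurable unit_leb"
  by (rule continuous_imp_measurable_on_sets_lebesgue[OF assms]) auto

lemma borel_measurable_unit_leb:
  fixes f :: "real \<Rightarrow> 'a::topological_space"
  assumes "f \<in> borel_measurable borel"
  shows "f \<in> borel_measurable unit_leb"
proof -
  have "f \<in> borel_measurable lebesgue" using assms by (simp add: measurable_completion)
  then show ?thesis by (rule measurable_restrict_space1)
qed

lemma sets_unit_leb: "A \<in> sets borel \<Longrightarrow> A \<subseteq> {0<..<1} \<Longrightarrow> A \<in> sets unit_leb"
  by (simp add: sets_restrict_space_iff)

lemma AE_unit_leb_neq: "AE y in unit_leb. y \<noteq> (x::real)"
proof -
  have "{x} \<in> null_sets lebesgue" by simp
  then have "AE y in lebesgue. y \<notin> {x}" by (rule AE_not_in)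
  then show ?thesis by (subst AE_restrict_space_iff) auto
qed

lemma AE_unit_leb_in: "AE y in unit_leb. 0 < y \<and> y < 1"
  by (rule AE_I2) auto

lemma integrable_unit_leb_indicator:
  fixes g :: "real \<Rightarrow> real"
  assumes "integrable unit_leb g" "A \<in> sets borel"
  shows "integrable unit_leb (\<lambda>y. indicator A y * g y)"
proof (rule Bochner_Integration.integrable_bound[OF assms(1)])
  show "(\<lambda>y. indicator A y * g y) \<in> borel_measurable unit_leb"
    using assms borel_measurable_unit_leb[of "indicator A :: real \<Rightarrow> real"]
    by (intro borel_measurable_times) auto
qed (auto simp: indicator_def)

lemma has_bochner_integral_unit_leb_FTC:
  fixes f F :: "real \<Rightarrow> real"
  assumes F: "\<And>x. (F has_real_derivative f x) (at x)" and f: "continuous_on UNIV f"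
    and y: "0 \<le> y" "y \<le> 1"
  shows "has_bochner_integral unit_leb (\<lambda>x. indicator {..y} x * f x) (F y - F 0)"
proof -
  have "has_bochner_integral lborel (\<lambda>x. f x * indicator {0..y} x) (F y - F 0)"
    by (rule has_bochner_integral_FTC_Icc_real)
       (use F f y in \<open>auto simp: continuous_on_eq_continuous_at\<close>)
  then have 1: "has_bochner_integral lebesgue (\<lambda>x. f x * indicator {0..y} x) (F y - F 0)"
    unfolding has_bochner_integral_iff
    by (metis (no_types, lifting) integrable_completion integral_completion borel_measurable_integrable)
  \<comment> \<open>The interval {0..y} and the part of the open unit interval up to y differ at
    most in these endpoints.\<close>
  have "AE x in lebesgue. x \<notin> {0, 1::real}" by (rule AE_not_in) simp
  then have 2: "AE x in lebesgue. f x * indicator {0..y} x = indicator {0<..<1} x *\<^sub>R (indicator {..y} x * f x)"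
    by eventually_elim (use y in \<open>auto simp: indicator_def\<close>)
  have "f \<in> borel_measurable lebesgue"
    using borel_measurable_continuous_onI[OF f] by (simp add: measurable_completion)
  then have "(\<lambda>x. indicator {0<..<1} x *\<^sub>R (indicator {..y} x * f x)) \<in> borel_measurable lebesgue"
    by (intro borel_measurable_scaleR borel_measurable_times borel_measurable_indicator) auto
  then have "has_bochner_integral lebesgue (\<lambda>x. indicator {0<..<1} x *\<^sub>R (indicator {..y} x * f x)) (F y - F 0)"
    using has_bochner_integral_cong_AE[OF borel_measurable_has_bochner_integral[OF 1] _ 2] 1 by blast
  then show ?thesis
    by (subst has_bochner_integral_restrict_space) auto
qed

text \<open>A second difference of the \<open>C\<^sup>1\<close> function \<open>(max 0 t)\<^sup>2\<close>: it rises from 0 to 2 on \<open>[-1, 1]\<close>,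
  with the hat function as derivative.\<close>

definition step :: "real \<Rightarrow> real" where
  "step t = (max 0 (t + 1))\<^sup>2 - 2 * (max 0 t)\<^sup>2 + (max 0 (t - 1))\<^sup>2"

definition hat :: "real \<Rightarrow> real" where
  "hat t = 2 * (max 0 (t + 1) - 2 * max 0 t + max 0 (t - 1))"

lemma has_real_derivative_max0_sq: "((\<lambda>t::real. (max 0 t)\<^sup>2) has_real_derivative 2 * max 0 t) (at t)"
proof (cases "t = 0")
  case False
  show ?thesis
  proof (cases "t > 0")
    case True
    have "((\<lambda>t::real. t\<^sup>2) has_real_derivative 2 * max 0 t) (at t)"
      using True by (auto intro!: derivative_eq_intros)
    then show ?thesis
      by (rule has_field_derivative_transform_within_open[where S="{0<..}"]) (use True in auto)
  next
    case f: False
    have "((\<lambda>t::real. 0) has_real_derivative 2 * max 0 t) (at t)"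
      using f False by (auto intro!: derivative_eq_intros)
    then show ?thesis
      by (rule has_field_derivative_transform_within_open[where S="{..<0}"]) (use f False in auto)
  qed
next
  case True
  \<comment> \<open>At the kink the difference quotient equals h or 0, so |h| dominates it.\<close>
  have "((\<lambda>h::real. (max 0 h)\<^sup>2 / h) \<longlongrightarrow> 0) (at 0)"
  proof (rule Lim_null_comparison[where g="\<lambda>h. \<bar>h\<bar>"])
    show "\<forall>\<^sub>F h in at (0::real). norm ((max 0 h)\<^sup>2 / h) \<le> \<bar>h\<bar>"
      by (rule always_eventually) (auto simp: max_def power2_eq_square)
    show "((\<lambda>h::real. \<bar>h\<bar>) \<longlongrightarrow> 0) (at 0)"
      by (auto intro!: tendsto_eq_intros)
  qed
  then show ?thesis using True by (simp add: DERIV_def)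
qed

lemma has_real_derivative_step: "(step has_real_derivative hat t) (at t)"
proof -
  have 1: "((\<lambda>t::real. (max 0 (t + c))\<^sup>2) has_real_derivative 2 * max 0 (t + c) * 1) (at t)" for c
    by (rule DERIV_chain'[where g="\<lambda>t. (max 0 t)\<^sup>2" and f="\<lambda>t. t + c"])
       (auto intro!: derivative_eq_intros has_real_derivative_max0_sq)
  show ?thesis
    unfolding step_def[abs_def] hat_def
    using DERIV_add[OF DERIV_diff[OF 1[of 1] DERIV_cmult[OF 1[of 0], of 2]] 1[of "-1"]]
    by (simp add: algebra_simps)
qed

lemma step_left: "t \<le> -1 \<Longrightarrow> step t = 0" by (simp add: step_def)
lemma step_right: "t \<ge> 1 \<Longrightarrow> step t = 2" by (simp add: step_def power2_eq_square algebra_simps)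
lemma hat_nonneg: "hat t \<ge> 0" by (auto simp: hat_def max_def)
lemma hat_zero: "\<bar>t\<bar> \<ge> 1 \<Longrightarrow> hat t = 0" by (auto simp: hat_def max_def)
lemma continuous_hat: "continuous_on UNIV hat"
  unfolding hat_def[abs_def] by (intro continuous_intros)

lemma has_real_derivative_scaled_step:
  assumes "e > 0"
  shows "((\<lambda>x. step ((x - a) / e)) has_real_derivative hat ((x - a) / e) / e) (at x)"
proof -
  have "((\<lambda>x. step ((x - a) / e)) has_real_derivative hat ((x - a) / e) * (1 / e)) (at x)"
    by (rule DERIV_chain'[where g=step and f="\<lambda>x. (x - a) / e"])
       (use assms in \<open>auto intro!: derivative_eq_intros has_real_derivative_step\<close>)
  then show ?thesis by simp
qed

lemma continuous_scaled_hat: 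
  assumes "e > 0"
  shows "continuous_on S (\<lambda>x. hat ((x - a) / e) / e)"
proof -
  have "continuous_on S (\<lambda>x. hat ((x - a) / e))"
    by (rule continuous_on_compose2[OF continuous_hat]) (use assms in \<open>auto intro!: continuous_intros\<close>)
  then show ?thesis using assms by (auto intro!: continuous_intros)
qed

lemma integral_scaled_hat:
  assumes "e > 0" "0 < a - e" "a + e < 1"
  shows "integrable unit_leb (\<lambda>x. hat ((x - a) / e) / e)"
    and "(LINT x|unit_leb. hat ((x - a) / e) / e) = 2"
proof -
  let ?f = "\<lambda>x. hat ((x - a) / e) / e"
  have "step ((1 - a) / e) = 2" using assms by (intro step_right) (auto simp: field_simps)
  moreover have "step ((0 - a) / e) = 0" using assms by (intro step_left) (auto simp: field_simps)
  moreover have "has_bochner_integral unit_leb (\<lambda>x. indicator {..1} x * ?f x) 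
      (step ((1 - a) / e) - step ((0 - a) / e))"
    by (rule has_bochner_integral_unit_leb_FTC)
       (use assms has_real_derivative_scaled_step continuous_scaled_hat in auto)
  ultimately have "has_bochner_integral unit_leb (\<lambda>x. indicator {..1} x * ?f x) 2" by simp
  also have "?this \<longleftrightarrow> has_bochner_integral unit_leb ?f 2"
    by (rule has_bochner_integral_cong) auto
  finally show "integrable unit_leb ?f" "(LINT x|unit_leb. ?f x) = 2"
    by (auto simp: has_bochner_integral_iff)
qed

text \<open>One step alone is not compactly supported; two of them cancel to the right of both
  ramps. The derivative is a difference of bumps, which compares averages near a and near b.\<close>

lemma test_function_step_difference:
  assumes "e > 0" "0 < a - e" "a + e < 1" "0 < b - e" "b + e < 1"
  defines "\<psi> \<equiv> \<lambda>x. step ((x - a) / e) - step ((x - b) / e)"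
  shows "test_function \<psi>" "deriv \<psi> x = hat ((x - a) / e) / e - hat ((x - b) / e) / e"
proof -
  have d: "(\<psi> has_real_derivative hat ((x - a) / e) / e - hat ((x - b) / e) / e) (at x)" for x
    unfolding \<psi>_def by (intro DERIV_diff has_real_derivative_scaled_step assms)
  then have dd: "deriv \<psi> x = hat ((x - a) / e) / e - hat ((x - b) / e) / e" for x
    by (rule DERIV_imp_deriv)
  then show "deriv \<psi> x = hat ((x - a) / e) / e - hat ((x - b) / e) / e" .
  have z: "\<psi> x = 0" if "x \<notin> {min a b - e..max a b + e}" for x
  proof (cases "x < min a b - e")
    case True
    then show ?thesis unfolding \<psi>_def using assms by (simp add: step_left field_simps)
  next
    case False
    then have "x > max a b + e" using that by auto
    then show ?thesis unfolding \<psi>_def using assms by (simp add: step_right field_simps)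
  qed
  show "test_function \<psi>"
    unfolding test_function_def
  proof (intro conjI allI)
    show "\<psi> differentiable at x" for x using d real_differentiable_def by blast
    show "continuous_on UNIV (deriv \<psi>)"
      unfolding dd[abs_def] by (intro continuous_on_diff continuous_scaled_hat assms)
    show "\<exists>a b. 0 < a \<and> b < 1 \<and> (\<forall>x. x \<notin> {a..b} \<longrightarrow> \<psi> x = 0)"
      using z assms by (intro exI[of _ "min a b - e"] exI[of _ "max a b + e"]) auto
  qed
qed

text \<open>The bumps have mass 2, hence the factor 2. The estimate holds for every small width e,
  so that one width can serve two centers at once.\<close>

lemma integral_scaled_hat_tendsto:
  fixes u :: "real \<Rightarrow> real"
  assumes u: "continuous_on {0..1} u" and a: "0 < a" "a < 1" and "\<eta> > 0"
  shows "\<exists>d>0. \<forall>e. 0 < e \<longrightarrow> e < d \<longrightarrow> 0 < a - e \<and> a + e < 1 \<and> 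
     integrable unit_leb (\<lambda>x. u x * (hat ((x - a) / e) / e)) \<and>
     \<bar>(LINT x|unit_leb. u x * (hat ((x - a) / e) / e)) - 2 * u a\<bar> \<le> 2 * \<eta>"
proof -
  obtain d where d: "d > 0" "\<And>x. x \<in> {0..1} \<Longrightarrow> dist x a < d \<Longrightarrow> dist (u x) (u a) < \<eta>"
    using u a \<open>\<eta> > 0\<close> unfolding continuous_on_iff by (metis atLeastAtMost_iff less_eq_real_def)
  obtain B where B: "\<And>x. x \<in> {0..1} \<Longrightarrow> \<bar>u x\<bar> \<le> B"
    using compact_imp_bounded[OF compact_continuous_image[OF u]] unfolding bounded_real by (metis compact_Icc imageI)
  have main: "0 < a - e \<and> a + e < 1 \<and> 
     integrable unit_leb (\<lambda>x. u x * (hat ((x - a) / e) / e)) \<and>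
     \<bar>(LINT x|unit_leb. u x * (hat ((x - a) / e) / e)) - 2 * u a\<bar> \<le> 2 * \<eta>"
    if e: "0 < e" "e < min d (min a (1 - a))" for e
  proof -
    define f where "f = (\<lambda>x. hat ((x - a) / e) / e)"
    have ae: "0 < a - e" "a + e < 1" using e by auto
    note i = integral_scaled_hat[OF e(1) ae, folded f_def]
    have f0: "f x \<ge> 0" for x unfolding f_def using hat_nonneg e by simp
    have m: "(\<lambda>x. u x * f x) \<in> borel_measurable unit_leb"
      unfolding f_def by (rule continuous_measurable_unit_leb)
         (intro continuous_on_mult continuous_scaled_hat e continuous_on_subset[OF u], auto)
    have int: "integrable unit_leb (\<lambda>x. u x * f x)"
    proof (rule Bochner_Integration.integrable_bound[where f="\<lambda>x. B * f x"])
      show "integrable unit_leb (\<lambda>x. B * f x)" by (intro integrable_mult_right) (rule i)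
      show "AE x in unit_leb. norm (u x * f x) \<le> norm (B * f x)"
      proof (rule AE_I2)
        fix x assume "x \<in> space unit_leb"
        then have "\<bar>u x\<bar> \<le> \<bar>B\<bar>" using B[of x] by auto
        then show "norm (u x * f x) \<le> norm (B * f x)"
          unfolding real_norm_def abs_mult by (rule mult_right_mono) simp
      qed
    qed (fact m)
    have "\<bar>(LINT x|unit_leb. u x * f x) - 2 * u a\<bar> = \<bar>(LINT x|unit_leb. u x * f x - u a * f x)\<bar>"
      using int i by (simp add: mult.commute)
    also have "\<dots> \<le> (LINT x|unit_leb. \<bar>u x * f x - u a * f x\<bar>)"
      by (rule integral_abs_bound)
    also have "\<dots> \<le> (LINT x|unit_leb. \<eta> * f x)"
    proof (rule integral_mono)
      fix x assume x: "x \<in> space unit_leb"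
      have "\<bar>u x - u a\<bar> * f x \<le> \<eta> * f x"
      proof (cases "\<bar>x - a\<bar> < e")
        case True
        then have "\<bar>u x - u a\<bar> \<le> \<eta>" using d(2)[of x] x e by (auto simp: dist_real_def)
        then show ?thesis using f0 by (rule mult_right_mono)
      next
        case False
        then have "f x = 0" unfolding f_def using e by (subst hat_zero) (auto simp: field_simps)
        then show ?thesis by simp
      qed
      then show "\<bar>u x * f x - u a * f x\<bar> \<le> \<eta> * f x"
        using f0 by (simp add: left_diff_distrib[symmetric] abs_mult)
    qed (use int i in auto)
    also have "\<dots> = 2 * \<eta>" using i by simp
    finally show ?thesis using int ae unfolding f_def by simp
  qed
  then show ?thesis using d a by (intro exI[of _ "min d (min a (1 - a))"]) auto
qed

text \<open>Testing with a difference of steps makes the bump averages of \<open>u\<close> at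
  \<open>a\<close> and \<open>b\<close> equal. Shrinking the bumps gives equal values inside the
  interval, and continuity reaches the endpoints.\<close>

lemma du_Bois_Reymond:
  fixes u :: "real \<Rightarrow> real"
  assumes u: "continuous_on {0..1} u"
    and z: "\<And>\<psi>. test_function \<psi> \<Longrightarrow> (LINT x|unit_leb. u x * deriv \<psi> x) = 0"
    and x: "x \<in> {0..1}"
  shows "u x = u 1"
proof -
  have eq: "u a = u b" if ab: "0 < a" "a < 1" "0 < b" "b < 1" for a b
  proof -
    have "\<bar>u a - u b\<bar> \<le> 0 + \<eta>" if "\<eta> > 0" for \<eta>
    proof -
      have "\<eta> / 2 > 0" using that by simp
      note h = integral_scaled_hat_tendsto[OF u ab(1,2) this] integral_scaled_hat_tendsto[OF u ab(3,4) this]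
      from h obtain d1 d2 where d: "d1 > 0" "d2 > 0" and 
        h1: "\<And>e. 0 < e \<Longrightarrow> e < d1 \<Longrightarrow> 0 < a - e \<and> a + e < 1 \<and> integrable unit_leb (\<lambda>x. u x * (hat ((x - a) / e) / e)) \<and>
         \<bar>(LINT x|unit_leb. u x * (hat ((x - a) / e) / e)) - 2 * u a\<bar> \<le> 2 * (\<eta> / 2)" and
        h2: "\<And>e. 0 < e \<Longrightarrow> e < d2 \<Longrightarrow> 0 < b - e \<and> b + e < 1 \<and> integrable unit_leb (\<lambda>x. u x * (hat ((x - b) / e) / e)) \<and>
         \<bar>(LINT x|unit_leb. u x * (hat ((x - b) / e) / e)) - 2 * u b\<bar> \<le> 2 * (\<eta> / 2)"
        by blast
      define e where "e = min d1 d2 / 2"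
      have e: "0 < e" "e < d1" "e < d2" using d by (auto simp: e_def)
      note g1 = h1[OF e(1,2)] and g2 = h2[OF e(1,3)]
      have t: "test_function (\<lambda>x. step ((x - a) / e) - step ((x - b) / e))"
        using g1 g2 e by (intro test_function_step_difference) auto
      have dd: "deriv (\<lambda>x. step ((x - a) / e) - step ((x - b) / e)) x = hat ((x - a) / e) / e - hat ((x - b) / e) / e" for x
        using g1 g2 e by (intro test_function_step_difference) auto
      from z[OF t] have "(LINT x|unit_leb. u x * (hat ((x - a) / e) / e) - u x * (hat ((x - b) / e) / e)) = 0"
        unfolding dd by (simp add: right_diff_distrib)
      then have "(LINT x|unit_leb. u x * (hat ((x - a) / e) / e)) = (LINT x|unit_leb. u x * (hat ((x - b) / e) / e))"
        using g1 g2 by simp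
      then show ?thesis using g1 g2 by linarith
    qed
    then have "\<bar>u a - u b\<bar> \<le> 0" by (rule field_le_epsilon)
    then show ?thesis by simp
  qed
  have cl: "closure {0<..<1::real} = {0..1}" by simp
  have "u x = u (1/2)" if "x \<in> {0..1}" for x
    by (rule continuous_constant_on_closure[of "{0<..<1}" u "u (1/2)"])
       (use u that eq in \<open>auto simp: cl\<close>)
  from this[OF x] this[of 1] show ?thesis by simp
qed

section \<open>Integration by parts for primitives\<close>

lemma test_function_deriv:
  assumes "test_function \<psi>"
  shows "(\<psi> has_real_derivative deriv \<psi> x) (at x)"
  using assms unfolding test_function_def
  by (metis DERIV_imp_deriv real_differentiable_def)

lemma test_function_integral:
  assumes "test_function \<psi>" "0 \<le> y" "y \<le> 1"
  shows "has_bochner_integral unit_leb (\<lambda>x. indicator {..y} x * deriv \<psi> x) (\<psi> y)"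
proof -
  have "\<psi> 0 = 0" using assms(1) unfolding test_function_def by force
  with has_bochner_integral_unit_leb_FTC[of \<psi> "deriv \<psi>" y] show ?thesis
    using test_function_deriv assms unfolding test_function_def by auto
qed

lemma test_function_deriv_bounded:
  assumes "test_function \<psi>"
  obtains B where "B \<ge> 0" "\<And>x. x \<in> {0<..<1} \<Longrightarrow> \<bar>deriv \<psi> x\<bar> \<le> B"
proof -
  have "continuous_on {0..1} (deriv \<psi>)"
    using assms continuous_on_subset unfolding test_function_def by blast
  then have "bounded (deriv \<psi> ` {0..1})"
    by (intro compact_imp_bounded compact_continuous_image) auto
  then obtain B where B: "\<And>x. x \<in> {0..1} \<Longrightarrow> \<bar>deriv \<psi> x\<bar> \<le> B"
    unfolding bounded_real by (metis imageI)
  have "B \<ge> 0" using B[of 0] by auto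
  with B that show ?thesis by auto
qed

lemma test_function_deriv_measurable:
  "test_function \<psi> \<Longrightarrow> deriv \<psi> \<in> borel_measurable unit_leb"
  unfolding test_function_def using continuous_on_subset
  by (intro continuous_measurable_unit_leb) blast

lemma integrable_times_test_deriv:
  assumes "test_function \<psi>" "integrable unit_leb r"
  shows "integrable unit_leb (\<lambda>x. r x * deriv \<psi> x)"
proof -
  obtain B where B: "B \<ge> 0" "\<And>x. x \<in> {0<..<1} \<Longrightarrow> \<bar>deriv \<psi> x\<bar> \<le> B"
    using test_function_deriv_bounded[OF assms(1)] by blast
  show ?thesis
  proof (rule Bochner_Integration.integrable_bound[where f="\<lambda>x. r x * B"])
    show "(\<lambda>x. r x * deriv \<psi> x) \<in> borel_measurable unit_leb"
      using assms test_function_deriv_measurable by auto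
    show "AE x in unit_leb. norm (r x * deriv \<psi> x) \<le> norm (r x * B)"
      using B by (intro AE_I2) (auto simp: abs_mult intro!: mult_left_mono)
  qed (use assms in simp)
qed

text \<open>Dominated convergence: the indicators of the moving half lines converge at every point
  except \<open>x\<close>, which is null.\<close>

lemma continuous_on_tail:
  assumes g: "integrable unit_leb g"
  shows "continuous_on UNIV (tail g)"
proof (rule continuous_at_imp_continuous_on, rule ballI, unfold isCont_def, rule tendsto_at_iff_sequentially[THEN iffD2], intro allI impI)
  fix x and X :: "nat \<Rightarrow> real" assume "X \<longlonglongrightarrow> x"
  show "((tail g \<circ> X) \<longlongrightarrow> tail g x) sequentially"
    unfolding o_def tail_def
  proof (rule integral_dominated_convergence)
    show "integrable unit_leb (\<lambda>y. norm (g y))" using g by simp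
    show "(\<lambda>y. indicator {x..} y * g y) \<in> borel_measurable unit_leb"
         "(\<lambda>y. indicator {X i..} y * g y) \<in> borel_measurable unit_leb" for i
      using integrable_unit_leb_indicator[OF g] by auto
    show "AE y in unit_leb. norm (indicator {X i..} y * g y) \<le> norm (g y)" for i
      by (auto simp: indicator_def)
    have *: "(\<lambda>i. indicator {X i..} y * g y) \<longlonglongrightarrow> indicator {x..} y * g y" if "y \<noteq> x" for y
    proof (rule tendsto_eventually, cases "x < y")
      case True
      then have "\<forall>\<^sub>F i in sequentially. X i < y" using order_tendstoD(2)[OF \<open>X \<longlonglongrightarrow> x\<close>] by auto
      then show "\<forall>\<^sub>F i in sequentially. indicator {X i..} y * g y = indicator {x..} y * g y"
        by eventually_elim (use True in \<open>auto simp: indicator_def\<close>)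
    next
      case False
      then have "\<forall>\<^sub>F i in sequentially. y < X i" using that order_tendstoD(1)[OF \<open>X \<longlonglongrightarrow> x\<close>] by auto
      then show "\<forall>\<^sub>F i in sequentially. indicator {X i..} y * g y = indicator {x..} y * g y"
        by eventually_elim (use False that in \<open>auto simp: indicator_def\<close>)
    qed
    show "AE y in unit_leb. (\<lambda>i. indicator {X i..} y * g y) \<longlonglongrightarrow> indicator {x..} y * g y"
      using AE_unit_leb_neq[of x] by eventually_elim (use * in auto)
  qed
qed

lemma integrable_tail:
  assumes g: "integrable unit_leb g"
  shows "integrable unit_leb (tail g)"
proof -
  interpret finite_measure unit_leb by (rule finite_unit_leb)
  have "bounded (tail g ` {0..1})"
    by (intro compact_imp_bounded compact_continuous_image continuous_on_subset[OF continuous_on_tail[OF g]]) auto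
  then obtain B where B: "\<And>x. x \<in> {0..1} \<Longrightarrow> \<bar>tail g x\<bar> \<le> B"
    unfolding bounded_real by (metis imageI)
  show ?thesis
    by (rule integrable_const_bound[where B=B])
       (use B in \<open>auto intro!: continuous_measurable_unit_leb continuous_on_subset[OF continuous_on_tail[OF g]]\<close>)
qed

text \<open>Fubini on the triangle x <= y: integrating the derivative of the test function in x
  first leaves its value at y, as it vanishes at 0.\<close>

lemma integral_tail_test:
  assumes g: "integrable unit_leb g" and t: "test_function \<psi>"
  shows "(LINT x|unit_leb. tail g x * deriv \<psi> x) = (LINT y|unit_leb. g y * \<psi> y)"
proof -
  interpret finite_measure unit_leb by (rule finite_unit_leb)
  interpret P: pair_sigma_finite unit_leb unit_leb ..
  obtain B where B: "B \<ge> 0" "\<And>x. x \<in> {0<..<1} \<Longrightarrow> \<bar>deriv \<psi> x\<bar> \<le> B"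
    using test_function_deriv_bounded[OF t] by blast
  have [measurable]: "g \<in> borel_measurable unit_leb" using g by auto
  have [measurable]: "deriv \<psi> \<in> borel_measurable unit_leb" by (rule test_function_deriv_measurable[OF t])
  have [measurable]: "(\<lambda>x. x) \<in> borel_measurable unit_leb" by (intro borel_measurable_unit_leb) auto
  define f where "f x y = (if x \<le> y then 1 else 0) * g y * deriv \<psi> x" for x y
  \<comment> \<open>This majorant of the triangle integrand depends on y alone, since a test
    function has bounded derivative.\<close>
  have 1: "integrable (unit_leb \<Otimes>\<^sub>M unit_leb) (\<lambda>(x, y). g y * B)"
    by (rule P.Fubini_integrable) (use g in auto)
  have "integrable (unit_leb \<Otimes>\<^sub>M unit_leb) (\<lambda>(x, y). f x y)"
  proof (rule Bochner_Integration.integrable_bound[OF 1])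
    show "(\<lambda>(x, y). f x y) \<in> borel_measurable (unit_leb \<Otimes>\<^sub>M unit_leb)"
      unfolding f_def by measurable
    show "AE x in unit_leb \<Otimes>\<^sub>M unit_leb. norm (case x of (x, y) \<Rightarrow> f x y) \<le> norm (case x of (x, y) \<Rightarrow> g y * B)"
      by (rule AE_I2) (use B in \<open>auto simp: f_def space_pair_measure abs_mult intro!: mult_left_mono\<close>)
  qed
  note F = P.Fubini_integral[OF this]
  have "(LINT x|unit_leb. tail g x * deriv \<psi> x) = (LINT x|unit_leb. (LINT y|unit_leb. f x y))"
  proof (rule Bochner_Integration.integral_cong[OF refl])
    fix x
    have "f x y = (indicator {x..} y * g y) * deriv \<psi> x" for y by (auto simp: f_def indicator_def)
    then show "tail g x * deriv \<psi> x = (LINT y|unit_leb. f x y)" by (simp add: tail_def)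
  qed
  also have "\<dots> = (LINT y|unit_leb. (LINT x|unit_leb. f x y))" using F by simp
  also have "\<dots> = (LINT y|unit_leb. g y * \<psi> y)"
  proof (rule Bochner_Integration.integral_cong[OF refl])
    fix y assume y: "y \<in> space unit_leb"
    have "f x y = g y * (indicator {..y} x * deriv \<psi> x)" for x by (auto simp: f_def indicator_def)
    then show "(LINT x|unit_leb. f x y) = g y * \<psi> y" 
      using has_bochner_integral_integral_eq[OF test_function_integral[OF t, of y]] y by simp
  qed
  finally show ?thesis .
qed

text \<open>The constant \<open>c\<close> is tested against a derivative whose integral is the
  boundary value at 1, which is 0.\<close>

lemma has_weak_derivative_tail:
  assumes g: "integrable unit_leb g" and r: "\<And>x. x \<in> {0<..<1} \<Longrightarrow> r x = c - tail g x"
  shows "has_weak_derivative r g"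
  unfolding has_weak_derivative_def
proof (intro conjI g allI impI)
  fix \<psi> assume t: "test_function \<psi>"
  have "has_bochner_integral unit_leb (\<lambda>x. indicator {..1} x * deriv \<psi> x) (\<psi> 1)"
    by (rule test_function_integral[OF t]) auto
  also have "?this \<longleftrightarrow> has_bochner_integral unit_leb (deriv \<psi>) (\<psi> 1)"
    by (rule has_bochner_integral_cong) auto
  finally have d: "has_bochner_integral unit_leb (deriv \<psi>) (\<psi> 1)" .
  have p1: "\<psi> 1 = 0" using t unfolding test_function_def by force
  have "(LINT x|unit_leb. r x * deriv \<psi> x) = (LINT x|unit_leb. c * deriv \<psi> x - tail g x * deriv \<psi> x)"
    by (rule Bochner_Integration.integral_cong) (auto simp: r algebra_simps)
  also have "\<dots> = c * \<psi> 1 - (LINT y|unit_leb. g y * \<psi> y)"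
    using d integrable_times_test_deriv[OF t integrable_tail[OF g]] integral_tail_test[OF g t]
    by (simp add: has_bochner_integral_iff)
  finally show "(LINT x|unit_leb. r x * deriv \<psi> x) = - (LINT x|unit_leb. g x * \<psi> x)"
    using p1 by simp
qed

section \<open>Uniqueness of weak derivatives\<close>

lemma tail_1 [simp]: "tail g 1 = 0"
proof -
  have "tail g 1 = (LINT y|unit_leb. 0)"
    unfolding tail_def by (rule Bochner_Integration.integral_cong) auto
  then show ?thesis by simp
qed

lemma integrable_continuous_unit_leb:
  fixes r :: "real \<Rightarrow> real"
  assumes "continuous_on {0..1} r"
  shows "integrable unit_leb r"
proof -
  interpret finite_measure unit_leb by (rule finite_unit_leb)
  obtain B where "\<And>x. x \<in> {0..1} \<Longrightarrow> \<bar>r x\<bar> \<le> B"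
    using compact_imp_bounded[OF compact_continuous_image[OF assms]] unfolding bounded_real 
    by (metis compact_Icc imageI)
  then show ?thesis
    by (intro integrable_const_bound[where B=B])
       (auto intro!: continuous_measurable_unit_leb continuous_on_subset[OF assms])
qed

text \<open>By \<open>integral_tail_test\<close> the sum of \<open>r\<close> and
  \<open>tail g\<close> has zero weak derivative, so it is constant; its value is read off at
  1.\<close>

lemma weak_derivative_imp_tail:
  assumes r: "continuous_on {0..1} r" and g: "has_weak_derivative r g" and x: "x \<in> {0..1}"
  shows "r x = r 1 - tail g x"
proof -
  have ig: "integrable unit_leb g" using g by (simp add: has_weak_derivative_def)
  have "r x + tail g x = r 1 + tail g 1"
  proof (rule du_Bois_Reymond[OF _ _ x])
    show "continuous_on {0..1} (\<lambda>x. r x + tail g x)"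
      by (intro continuous_on_add r continuous_on_subset[OF continuous_on_tail[OF ig]]) auto
    fix \<psi> assume t: "test_function \<psi>"
    have "(LINT x|unit_leb. (r x + tail g x) * deriv \<psi> x) = 
        (LINT x|unit_leb. r x * deriv \<psi> x) + (LINT x|unit_leb. tail g x * deriv \<psi> x)"
      using integrable_times_test_deriv[OF t integrable_continuous_unit_leb[OF r]]
        integrable_times_test_deriv[OF t integrable_tail[OF ig]]
      by (simp add: distrib_right)
    also have "\<dots> = 0"
      using g t integral_tail_test[OF ig t] by (simp add: has_weak_derivative_def)
    finally show "(LINT x|unit_leb. (r x + tail g x) * deriv \<psi> x) = 0" .
  qed
  then show ?thesis by simp
qed

text \<open>Integrals of \<open>g\<close> over intervals are differences of tails and vanish;
  induction over Borel sets extends this to the sets where \<open>g\<close> has a given sign, up to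
  null sets.\<close>

lemma tail_zero_imp_AE_zero:
  assumes g: "integrable unit_leb g" and z: "\<And>x. x \<in> {0..1} \<Longrightarrow> tail g x = 0"
  shows "AE x in unit_leb. g x = 0"
proof -
  \<comment> \<open>The induction meets intervals anywhere on the line, so the tails are needed off
    [0, 1] too.\<close>
  have z': "tail g x = 0" for x
  proof -
    consider "x \<in> {0..1}" | "x < 0" | "x > 1" by fastforce
    then show ?thesis
    proof cases
      case 2
      then have "tail g x = tail g 0"
        unfolding tail_def by (intro Bochner_Integration.integral_cong) (auto simp: indicator_def)
      then show ?thesis using z by simp
    next
      case 3
      then have "tail g x = (LINT y|unit_leb. 0)"
        unfolding tail_def by (intro Bochner_Integration.integral_cong) (auto simp: indicator_def)
      then show ?thesis by simp
    qed (fact z)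
  qed
  have ii: "integrable unit_leb (\<lambda>y. indicator A y * g y)" if "A \<in> sets borel" for A
    by (rule integrable_unit_leb_indicator[OF g that])
  have zero: "(LINT y|unit_leb. indicator A y * g y) = 0" if "A \<in> sets borel" for A
    using that
  proof (induction rule: borel_set_induct)
    case empty
    then show ?case by simp
  next
    case (interval a b)
    have "(LINT y|unit_leb. indicator {a..b} y * g y) = 
        (LINT y|unit_leb. indicator {a..} y * g y - indicator {b..} y * g y)"
    proof (rule integral_cong_AE)
      show "AE y in unit_leb. indicator {a..b} y * g y = indicator {a..} y * g y - indicator {b..} y * g y"
        using AE_unit_leb_neq[of b] by eventually_elim (use interval in \<open>auto simp: indicator_def\<close>)
    qed (use ii in \<open>auto intro!: borel_measurable_diff borel_measurable_integrable\<close>)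
    also have "\<dots> = tail g a - tail g b"
      using ii[of "{a..}"] ii[of "{b..}"] by (simp add: tail_def)
    finally show ?case using z' by simp
  next
    case (compl A)
    have "(LINT y|unit_leb. indicator (-A) y * g y) = (LINT y|unit_leb. indicator {0..} y * g y - indicator A y * g y)"
      by (rule Bochner_Integration.integral_cong) (auto simp: indicator_def)
    also have "\<dots> = tail g 0 - (LINT y|unit_leb. indicator A y * g y)"
      using ii[of "{0..}"] ii[of A] compl by (simp add: tail_def)
    finally show ?case using z' compl by simp
  next
    case (union f)
    have "(\<lambda>n. LINT y|unit_leb. indicator (\<Union>i<n. f i) y * g y) \<longlonglongrightarrow> (LINT y|unit_leb. indicator (\<Union>i. f i) y * g y)"
    proof (rule integral_dominated_convergence)
      show "integrable unit_leb (\<lambda>y. norm (g y))" using g by simp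
      show "AE y in unit_leb. norm (indicator (\<Union>i<n. f i) y * g y) \<le> norm (g y)" for n
        by (auto simp: indicator_def)
      show "AE y in unit_leb. (\<lambda>n. indicator (\<Union>i<n. f i) y * g y) \<longlonglongrightarrow> indicator (\<Union>i. f i) y * g y"
        by (intro AE_I2 tendsto_mult tendsto_const LIMSEQ_indicator_UN)
    qed (use ii union in \<open>auto intro!: borel_measurable_integrable\<close>)
    moreover have "(LINT y|unit_leb. indicator (\<Union>i<n. f i) y * g y) = 0" for n
    proof -
      have "(LINT y|unit_leb. indicator (\<Union>i<n. f i) y * g y) = (LINT y|unit_leb. (\<Sum>i<n. indicator (f i) y * g y))"
        using union(1) by (subst indicator_UN_disjoint)
          (auto simp: sum_distrib_right disjoint_family_on_def)
      also have "\<dots> = (\<Sum>i<n. (LINT y|unit_leb. indicator (f i) y * g y))"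
        using ii union by (intro Bochner_Integration.integral_sum) auto
      finally show ?thesis using union by simp
    qed
    ultimately have "(\<lambda>n. 0) \<longlonglongrightarrow> (LINT y|unit_leb. indicator (\<Union>i. f i) y * g y)" by simp
    then show ?case by (simp only: LIMSEQ_const_iff)
  qed
  \<comment> \<open>\<open>g\<close> is only Lebesgue measurable; a Borel representative has Borel
    sign sets, to which the induction applies.\<close>
  obtain g' where g'm: "g' \<in> borel_measurable borel" and g': "AE x in unit_leb. g x = g' x"
  proof -
    have "(\<lambda>x. indicator {0<..<1} x *\<^sub>R g x) \<in> borel_measurable lebesgue"
      using g borel_measurable_restrict_space_iff[of "{0<..<1}" lebesgue g] by auto
    then obtain g' where g': "g' \<in> borel_measurable lborel" 
        "AE x in lborel. indicator {0<..<1} x *\<^sub>R g x = g' x"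
      using completion_ex_borel_measurable_real[of _ lborel] by (metis (no_types))
    have "AE x in unit_leb. g x = g' x"
      using AE_completion[OF g'(2)] by (subst AE_restrict_space_iff) auto
    then show ?thesis using that g' by auto
  qed
  have sgn: "AE x in unit_leb. c * g x \<le> 0" for c :: real
  proof -
    define A where "A = {x. c * g' x > 0}"
    have A: "A \<in> sets borel" unfolding A_def using g'm by measurable
    have nn: "AE x in unit_leb. 0 \<le> c * (indicator A x * g x)"
      using g' by eventually_elim (auto simp: A_def indicator_def)
    have "AE x in unit_leb. c * (indicator A x * g x) = 0"
      using integral_nonneg_eq_0_iff_AE[OF _ nn] ii[OF A] zero[OF A] by simp
    with g' show ?thesis by eventually_elim (auto simp: A_def indicator_def split: if_splits)
  qed
  from sgn[of 1] sgn[of "-1"] show ?thesis by eventually_elim auto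
qed

lemma weak_derivative_unique:
  assumes r: "continuous_on {0..1} r" and g: "has_weak_derivative r g" "has_weak_derivative r g'"
  shows "AE x in unit_leb. g x = g' x"
proof -
  have i: "integrable unit_leb g" "integrable unit_leb g'" using g by (auto simp: has_weak_derivative_def)
  have "AE x in unit_leb. g x - g' x = 0"
  proof (rule tail_zero_imp_AE_zero)
    fix x :: real assume x: "x \<in> {0..1}"
    have "tail (\<lambda>x. g x - g' x) x = tail g x - tail g' x"
      using i[THEN integrable_unit_leb_indicator, of "{x..}"] by (simp add: tail_def right_diff_distrib)
    then show "tail (\<lambda>x. g x - g' x) x = 0"
      using weak_derivative_imp_tail[OF r g(1) x] weak_derivative_imp_tail[OF r g(2) x] by simp
  qed (use i in auto)
  then show ?thesis by eventually_elim simp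
qed

text \<open>The choice made by \<open>SOME\<close> in \<open>weak_deriv\<close> is immaterial,
  because a continuous function has at most one weak derivative up to null sets.\<close>

lemma weak_deriv_AE_eq:
  assumes r: "continuous_on {0..1} r" and g: "has_weak_derivative r g"
  shows "AE x in unit_leb. weak_deriv r x = g x"
  by (rule weak_derivative_unique[OF r _ g]) (use someI[of "has_weak_derivative r", OF g] g in \<open>auto simp: weak_deriv_def\<close>)

section \<open>Admissible deformations and their slopes\<close>

lemma I_mec_eq:
  assumes r: "continuous_on {0..1} r" and g: "has_weak_derivative r g"
  shows "I_mec \<Phi> r = (\<integral>\<^sup>+R. ennreal (\<Phi> R (g R) (r R / R) (r R / R) * R\<^sup>2) \<partial>unit_leb)"
  unfolding I_mec_def
  by (rule nn_integral_cong_AE) (use weak_deriv_AE_eq[OF assms] in auto)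

lemma admissibleE:
  assumes "r \<in> admissible \<Phi> l"
  obtains g where "integrable unit_leb g" "\<And>x. g x > 0" "has_weak_derivative r g"
    "\<And>x. x \<in> {0..1} \<Longrightarrow> r x = l - tail g x" "r 0 \<ge> 0"
    "continuous_on {0..1} r"
    "I_mec \<Phi> r = (\<integral>\<^sup>+R. ennreal (\<Phi> R (g R) (r R / R) (r R / R) * R\<^sup>2) \<partial>unit_leb)"
proof -
  from assms obtain g0 where r: "continuous_on {0..1} r" "r 1 = l" "r 0 \<ge> 0"
      "AE R in unit_leb. weak_deriv r R > 0" and g0: "has_weak_derivative r g0"
    unfolding admissible_def sobolev_W11_def by blast
  \<comment> \<open>On the exceptional null set the slope is reset to 1. The energy is controlled at
    positive stretches only, and positivity everywhere spares later arguments an exceptional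
    set.\<close>
  define g where "g x = (if g0 x > 0 then g0 x else 1)" for x
  have e: "AE x in unit_leb. g x = g0 x"
    using r(4) weak_deriv_AE_eq[OF r(1) g0] by eventually_elim (auto simp: g_def)
  have i0: "integrable unit_leb g0" using g0 by (simp add: has_weak_derivative_def)
  have [measurable]: "g0 \<in> borel_measurable unit_leb" using i0 by auto
  have m: "g \<in> borel_measurable unit_leb" unfolding g_def[abs_def] by measurable
  have i: "integrable unit_leb g"
    using integrable_cong_AE[OF m _ e] i0 by auto
  have "tail g x = tail g0 x" for x
    unfolding tail_def
    by (rule integral_cong_AE)
       (use e i i0 integrable_unit_leb_indicator in \<open>auto intro!: borel_measurable_integrable\<close>)
  then have t: "r x = l - tail g x" if "x \<in> {0..1}" for x
    using weak_derivative_imp_tail[OF r(1) g0 that] r by simp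
  have w: "has_weak_derivative r g"
    by (rule has_weak_derivative_tail[OF i]) (use t in auto)
  show ?thesis
    by (rule that[OF i _ w t r(3,1) I_mec_eq[OF r(1) w]]) (auto simp: g_def)
qed

lemma admissibleI:
  assumes g: "integrable unit_leb g" "AE x in unit_leb. g x > 0"
    and r: "\<And>x. x \<in> {0..1} \<Longrightarrow> r x = l - tail g x" "r 0 \<ge> 0"
    and fin: "(\<integral>\<^sup>+R. ennreal (\<Phi> R (g R) (r R / R) (r R / R) * R\<^sup>2) \<partial>unit_leb) < \<infinity>"
  shows "r \<in> admissible \<Phi> l"
proof -
  have w: "has_weak_derivative r g" by (rule has_weak_derivative_tail[OF g(1)]) (use r in auto)
  have c: "continuous_on {0..1} r"
  proof (rule continuous_on_eq)
    show "continuous_on {0..1} (\<lambda>x. l - tail g x)"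
      by (intro continuous_intros continuous_on_subset[OF continuous_on_tail[OF g(1)]]) auto
  qed (use r in auto)
  have "AE x in unit_leb. weak_deriv r x > 0"
    using g(2) weak_deriv_AE_eq[OF c w] by eventually_elim auto
  then show ?thesis
    using w c r integrable_continuous_unit_leb[OF c] fin I_mec_eq[OF c w, of \<Phi>]
    unfolding admissible_def sobolev_W11_def by auto
qed

lemma tail_less:
  assumes g: "integrable unit_leb g" "AE x in unit_leb. g x > 0" and x: "0 < x" "x < y" "y \<le> 1" 
  shows "tail g y < tail g x"
proof -
  interpret finite_measure unit_leb by (rule finite_unit_leb)
  note i = integrable_unit_leb_indicator[OF g(1)]
  have A: "{x..<y} \<in> sets unit_leb" using x by (intro sets_unit_leb) auto
  have ne: "emeasure unit_leb {x..<y} \<noteq> 0"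
    using x by (subst emeasure_restrict_space) auto
  show ?thesis
    unfolding tail_def
  proof (rule integral_less_AE[OF i i ne A])
    show "AE z in unit_leb. z \<in> {x..<y} \<longrightarrow> indicator {y..} z * g z \<noteq> indicator {x..} z * g z"
      using g(2) by eventually_elim (auto simp: indicator_def)
    show "AE z in unit_leb. indicator {y..} z * g z \<le> indicator {x..} z * g z"
      using g(2) by eventually_elim (use x in \<open>auto simp: indicator_def\<close>)
  qed auto
qed

lemma tail_mono:
  assumes g: "integrable unit_leb g" "AE x in unit_leb. g x \<ge> 0" and x: "x \<le> y"
  shows "tail g y \<le> tail g x"
  unfolding tail_def
proof (rule integral_mono_AE)
  show "AE z in unit_leb. indicator {y..} z * g z \<le> indicator {x..} z * g z"
    using g(2) by eventually_elim (use x in \<open>auto simp: indicator_def\<close>)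
qed (use integrable_unit_leb_indicator[OF g(1)] in auto)

lemma minus_tail_pos:
  assumes g: "integrable unit_leb g" "AE x in unit_leb. g x > 0" and x: "0 < x" "x \<le> 1" 
    and l: "l - tail g 0 \<ge> 0"
  shows "l - tail g x > 0"
proof -
  \<comment> \<open>\<open>tail_less\<close> asks for a positive left end, so the comparison with 0
    passes through x / 2.\<close>
  have "tail g x < tail g (x / 2)" by (rule tail_less[OF g]) (use x in auto)
  moreover have "AE x in unit_leb. g x \<ge> 0" using g(2) by eventually_elim auto
  then have "tail g (x / 2) \<le> tail g 0" by (rule tail_mono[OF g(1)]) (use x in auto)
  ultimately show ?thesis using l by simp
qed

section \<open>Convex combinations of tails of a sequence\<close>

text \<open>Weights of forward convex combinations, as in Mazur's lemma. As functions on all indices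
  they can be averaged pointwise, without a common range of summation.\<close>

definition tail_weights :: "nat \<Rightarrow> (nat \<Rightarrow> real) set" where
  "tail_weights n = {c. (\<forall>j. 0 \<le> c j) \<and> finite {j. c j \<noteq> 0} \<and> (\<forall>j<n. c j = 0) \<and> sum c {j. c j \<noteq> 0} = 1}"

definition wsum :: "(nat \<Rightarrow> real) \<Rightarrow> (nat \<Rightarrow> real) \<Rightarrow> real" where
  "wsum c a = (\<Sum>j | c j \<noteq> 0. c j * a j)"

lemma wsum_superset:
  assumes "finite S" "{j. c j \<noteq> 0} \<subseteq> S"
  shows "wsum c a = (\<Sum>j\<in>S. c j * a j)"
  unfolding wsum_def by (rule sum.mono_neutral_left) (use assms in auto)

lemma wsum_add: "wsum c (\<lambda>j. a j + b j) = wsum c a + wsum c b"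
  by (simp add: wsum_def distrib_left sum.distrib)

lemma wsum_diff: "wsum c (\<lambda>j. a j - b j) = wsum c a - wsum c b"
  by (simp add: wsum_def right_diff_distrib sum_subtractf)

lemma wsum_cmult: "wsum c (\<lambda>j. k * a j) = k * wsum c a"
  by (simp add: wsum_def sum_distrib_left mult.left_commute)

lemma wsum_const: "c \<in> tail_weights n \<Longrightarrow> wsum c (\<lambda>j. k) = k"
  by (auto simp: wsum_def tail_weights_def sum_distrib_right[symmetric])

lemma wsum_mono: 
  assumes "c \<in> tail_weights n" "\<And>j. j \<ge> n \<Longrightarrow> a j \<le> b j"
  shows "wsum c a \<le> wsum c b"
  unfolding wsum_def
proof (rule sum_mono)
  fix j assume "j \<in> {j. c j \<noteq> 0}"
  then have "j \<ge> n" using assms(1) by (auto simp: tail_weights_def not_less[symmetric])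
  then show "c j * a j \<le> c j * b j" using assms by (intro mult_left_mono) (auto simp: tail_weights_def)
qed

lemma wsum_abs_le:
  assumes "c \<in> tail_weights n"
  shows "\<bar>wsum c a\<bar> \<le> wsum c (\<lambda>j. \<bar>a j\<bar>)"
  unfolding wsum_def
  by (rule order_trans[OF sum_abs]) (use assms in \<open>auto simp: abs_mult tail_weights_def intro!: sum_mono\<close>)

lemma tail_weights_antimono: "n \<le> m \<Longrightarrow> tail_weights m \<subseteq> tail_weights n"
  by (auto simp: tail_weights_def)

lemma tail_weights_nonempty: "(\<lambda>j. if j = n then 1 else 0) \<in> tail_weights n"
  by (auto simp: tail_weights_def)

text \<open>Both weights are read over the union of their supports. Since the midpoint stays in the
  class, it can compete in the minimization of the entropy.\<close>

lemma tail_weights_midpoint: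
  assumes "c \<in> tail_weights n" "d \<in> tail_weights n"
  shows "(\<lambda>j. (c j + d j) / 2) \<in> tail_weights n"
    and "wsum (\<lambda>j. (c j + d j) / 2) a = (wsum c a + wsum d a) / 2"
proof -
  let ?S = "{j. c j \<noteq> 0} \<union> {j. d j \<noteq> 0}"
  have f: "finite ?S" using assms by (auto simp: tail_weights_def)
  have s: "{j. (c j + d j) / 2 \<noteq> 0} \<subseteq> ?S" by auto
  show eq: "wsum (\<lambda>j. (c j + d j) / 2) a = (wsum c a + wsum d a) / 2" for a
    using f s by (simp add: wsum_superset[of ?S] sum.distrib[symmetric] sum_divide_distrib algebra_simps add_divide_distrib)
  have "sum (\<lambda>j. (c j + d j) / 2) {j. (c j + d j) / 2 \<noteq> 0} = wsum (\<lambda>j. (c j + d j) / 2) (\<lambda>j. 1)"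
    by (simp add: wsum_def)
  also have "\<dots> = 1" unfolding eq using wsum_const[OF assms(1), of 1] wsum_const[OF assms(2), of 1] by simp
  finally show "(\<lambda>j. (c j + d j) / 2) \<in> tail_weights n"
    using finite_subset[OF s f] assms by (auto simp: tail_weights_def)
qed

lemma wsum_pos:
  assumes "c \<in> tail_weights n" "\<And>j. a j > 0"
  shows "wsum c a > 0"
proof -
  have ne: "{j. c j \<noteq> 0} \<noteq> {}" using assms(1) by (auto simp: tail_weights_def simp del: Collect_empty_eq)
  have cp: "c j > 0" if "c j \<noteq> 0" for j using assms(1) that by (auto simp: tail_weights_def less_le)
  show ?thesis unfolding wsum_def
    by (rule sum_pos) (use assms ne cp in \<open>auto simp: tail_weights_def\<close>)
qed

lemma wsum_convex:
  assumes "c \<in> tail_weights n" "convex_on S f" "\<And>j. a j \<in> S"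
  shows "f (wsum c a) \<le> wsum c (\<lambda>j. f (a j))"
proof -
  have ne: "{j. c j \<noteq> 0} \<noteq> {}" using assms(1) by (auto simp: tail_weights_def simp del: Collect_empty_eq)
  have "f (\<Sum>j | c j \<noteq> 0. c j *\<^sub>R a j) \<le> (\<Sum>j | c j \<noteq> 0. c j * f (a j))"
    by (rule convex_on_sum) (use assms ne in \<open>auto simp: tail_weights_def\<close>)
  then show ?thesis by (simp add: wsum_def)
qed

text \<open>The n-th weights see only indices from n on, where the sequence is already close to its
  limit.\<close>

lemma wsum_tendsto:
  assumes c: "\<And>n. c n \<in> tail_weights n" and a: "a \<longlonglongrightarrow> L"
  shows "(\<lambda>n. wsum (c n) a) \<longlonglongrightarrow> L"
proof (rule LIMSEQ_I)
  fix e :: real assume "e > 0"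
  then obtain N where N: "\<And>n. n \<ge> N \<Longrightarrow> norm (a n - L) < e / 2"
    using LIMSEQ_D[OF a, of "e / 2"] by auto
  have "norm (wsum (c n) a - L) < e" if "n \<ge> N" for n
  proof -
    have "wsum (c n) a - L = wsum (c n) (\<lambda>j. a j - L)" using wsum_const[OF c] by (simp add: wsum_diff)
    also have "\<bar>\<dots>\<bar> \<le> wsum (c n) (\<lambda>j. \<bar>a j - L\<bar>)" by (rule wsum_abs_le[OF c])
    also have "\<dots> \<le> wsum (c n) (\<lambda>j. e / 2)"
      by (rule wsum_mono[OF c]) (use N that in \<open>force intro: less_imp_le\<close>)
    also have "\<dots> = e / 2" by (rule wsum_const[OF c])
    finally show ?thesis using \<open>e > 0\<close> by simp
  qed
  then show "\<exists>N. \<forall>n\<ge>N. norm (wsum (c n) a - L) < e" by blast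
qed

lemma borel_measurable_wsum:
  assumes "\<And>j. f j \<in> borel_measurable M"
  shows "(\<lambda>x. wsum c (\<lambda>j. f j x)) \<in> borel_measurable M"
  unfolding wsum_def using assms by measurable

lemma integral_wsum:
  assumes "\<And>j. integrable M (f j)"
  shows "integrable M (\<lambda>x. wsum c (\<lambda>j. f j x))"
    and "(LINT x|M. wsum c (\<lambda>j. f j x)) = wsum c (\<lambda>j. LINT x|M. f j x)"
  unfolding wsum_def using assms by auto

section \<open>The entropy v ln v and strong compactness of averages\<close>

definition ent :: "real \<Rightarrow> real" where
  "ent v = v * ln v + 1"

text \<open>This is ln x <= x - 1 at x = 1 / v, and it explains the shift by 1 in
  \<open>ent\<close>: entropy bounds become L^1 bounds.\<close>

lemma ent_ge: "v > 0 \<Longrightarrow> ent v \<ge> v"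
proof -
  assume v: "v > 0"
  have "ln (1 / v) \<le> 1 / v - 1" using v by (intro ln_le_minus_one) auto
  then have "v * (1 - 1 / v) \<le> v * ln v" using v by (intro mult_left_mono) (auto simp: ln_div)
  then show ?thesis using v by (simp add: ent_def right_diff_distrib)
qed

text \<open>Again ln x <= x - 1, now at x = v powr (p - 1): a bound on any power above the first
  bounds the entropy.\<close>

lemma ent_le_powr:
  assumes "v > 0" "p > 1"
  shows "ent v \<le> v powr p / (p - 1) + 1"
proof -
  have "ln (v powr (p - 1)) \<le> v powr (p - 1) - 1" using assms by (intro ln_le_minus_one) auto
  then have "(p - 1) * ln v \<le> v powr (p - 1)" using assms by (simp add: ln_powr)
  then have "v * ((p - 1) * ln v) \<le> v * v powr (p - 1)" using assms by (intro mult_left_mono) auto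
  also have "\<dots> = v powr p" using assms by (simp add: powr_mult_base)
  finally show ?thesis using assms by (simp add: ent_def field_simps)
qed

lemma convex_on_ent: "convex_on {0<..} ent"
proof (rule f''_ge0_imp_convex)
  show "DERIV ent x :> ln x + 1" if "x \<in> {0<..}" for x
    unfolding ent_def[abs_def] using that by (auto intro!: derivative_eq_intros)
  show "DERIV (\<lambda>x. ln x + 1) x :> 1 / x" if "x \<in> {0<..}" for x :: real
    using DERIV_add[OF DERIV_ln_divide[of x] DERIV_const[of 1]] that by simp
qed auto

lemma borel_measurable_ent [measurable]: "ent \<in> borel_measurable borel"
  unfolding ent_def[abs_def] by measurable

text \<open>The difference of the two sides vanishes at 0 together with its derivative, and its
  second derivative is 2 x^2 / (1 - x^2).\<close>

lemma entropy_symmetric_lower: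
  fixes t :: real
  assumes "-1 < t" "t < 1"
  shows "(1 + t) * ln (1 + t) + (1 - t) * ln (1 - t) \<ge> t\<^sup>2"
proof -
  define f where "f t = (1 + t) * ln (1 + t) + (1 - t) * ln (1 - t) - t\<^sup>2" for t :: real
  have lp: "DERIV (\<lambda>x. ln (1 + x)) x :> 1 / (1 + x)" if "x \<in> {-1<..<1}" for x :: real
    using DERIV_chain'[where f="\<lambda>x. 1 + x" and g=ln and D=1 and E="1 / (1 + x)" and x=x and s=UNIV] that
      DERIV_ln_divide[of "1 + x"] by (auto intro!: derivative_eq_intros)
  have lm: "DERIV (\<lambda>x. ln (1 - x)) x :> - (1 / (1 - x))" if "x \<in> {-1<..<1}" for x :: real
    using DERIV_chain'[where f="\<lambda>x. 1 - x" and g=ln and D="-1" and E="1 / (1 - x)" and x=x and s=UNIV] that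
      DERIV_ln_divide[of "1 - x"] by (auto intro!: derivative_eq_intros)
  have "(ln (1 + 0) - ln (1 - 0) - 2 * 0) * (t - 0) \<le> f t - f 0"
  proof (rule f''_imp_f'[where C="{-1<..<1}" and f''="\<lambda>t. 1 / (1 + t) + 1 / (1 - t) - 2"])
    show "DERIV f x :> ln (1 + x) - ln (1 - x) - 2 * x" if "x \<in> {-1<..<1}" for x
    proof -
      have 1: "DERIV (\<lambda>x. 1 + x) x :> 1" "DERIV (\<lambda>x. 1 - x) x :> -1" "DERIV (\<lambda>x. x\<^sup>2) x :> 2 * x"
        by (auto intro!: derivative_eq_intros)
      from DERIV_diff[OF DERIV_add[OF DERIV_mult[OF 1(1) lp[OF that]] DERIV_mult[OF 1(2) lm[OF that]]] 1(3)]
      show ?thesis unfolding f_def[abs_def] using that by simp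
    qed
    show "DERIV (\<lambda>x. ln (1 + x) - ln (1 - x) - 2 * x) x :> 1 / (1 + x) + 1 / (1 - x) - 2" if "x \<in> {-1<..<1}" for x :: real
      using DERIV_diff[OF DERIV_diff[OF lp[OF that] lm[OF that]] DERIV_cmult[OF DERIV_ident, of 2]] by simp
    show "1 / (1 + x) + 1 / (1 - x) - 2 \<ge> 0" if "x \<in> {-1<..<1}" for x :: real
    proof -
      have "1 / (1 + x) + 1 / (1 - x) - 2 = 2 * x\<^sup>2 / ((1 + x) * (1 - x))"
      proof -
        have "1 + x \<noteq> 0" "1 - x \<noteq> 0" using that by auto
        then show ?thesis by (simp add: add_frac_eq diff_frac_eq) (simp add: divide_simps, simp add: algebra_simps power2_eq_square)
      qed
      also have "\<dots> \<ge> 0" using that by (intro divide_nonneg_nonneg) auto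
      finally show ?thesis .
    qed
  qed (use assms in auto)
  then show ?thesis by (simp add: f_def)
qed

text \<open>After integration this makes minimizing sequences of the entropy Cauchy in \<open>L\<^sup>1\<close>.\<close>

lemma entropy_midpoint_deficit:
  assumes ab: "a > 0" "b > 0" and \<eta>: "\<eta> > 0"
  shows "\<bar>a - b\<bar> \<le> (ent a + ent b - 2 * ent ((a + b) / 2)) / \<eta> + \<eta> * (a + b)"
proof -
  \<comment> \<open>Relative coordinates: a and b become m (1 + t) and m (1 - t), and the terms with
    ln m cancel in the deficit.\<close>
  define m t where "m = (a + b) / 2" and "t = (a - b) / (a + b)"
  have m: "m > 0" using ab by (simp add: m_def)
  have t: "-1 < t" "t < 1" using ab by (auto simp: t_def field_simps)
  have a: "a = m * (1 + t)" and b: "b = m * (1 - t)"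
    using ab by (auto simp: m_def t_def field_simps)
  have "ent a + ent b - 2 * ent m = m * ((1 + t) * ln (1 + t) + (1 - t) * ln (1 - t))"
  proof -
    have "ln (m * (1 + t)) = ln m + ln (1 + t)" "ln (m * (1 - t)) = ln m + ln (1 - t)"
      using m t by (auto simp: ln_mult)
    then show ?thesis unfolding a b ent_def by algebra
  qed
  also have "\<dots> \<ge> m * t\<^sup>2"
    using entropy_symmetric_lower[OF t] m by (intro mult_left_mono) auto
  finally have D: "ent a + ent b - 2 * ent m \<ge> m * t\<^sup>2" .
  \<comment> \<open>The deficit is quadratic in t while |a - b| is linear; this trades one for the
    other at the cost of \<open>\<eta>\<close> times a + b.\<close>
  have "0 \<le> (\<bar>t\<bar> - \<eta>)\<^sup>2" by simp
  then have "2 * \<bar>t\<bar> * \<eta> \<le> t\<^sup>2 + \<eta>\<^sup>2" by (simp add: power2_diff)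
  then have "m * (2 * \<bar>t\<bar> * \<eta>) / \<eta> \<le> m * (t\<^sup>2 + \<eta>\<^sup>2) / \<eta>"
    using m \<eta> by (intro divide_right_mono mult_left_mono) auto
  then have "2 * m * \<bar>t\<bar> \<le> m * t\<^sup>2 / \<eta> + m * \<eta>"
    using \<eta> by (simp add: field_simps power2_eq_square)
  also have "\<dots> \<le> (ent a + ent b - 2 * ent m) / \<eta> + \<eta> * (a + b)"
    using D \<eta> m ab by (intro add_mono divide_right_mono) (auto simp: m_def algebra_simps)
  also have "2 * m * \<bar>t\<bar> = \<bar>a - b\<bar>" 
    unfolding a b using m by (simp add: abs_mult right_diff_distrib distrib_left)
  finally show ?thesis by (simp add: m_def)
qed

text \<open>An almost everywhere Cauchy subsequence supplies the pointwise limit, and Fatou in the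
  second index turns the Cauchy bounds into bounds on the distance to that limit.\<close>

lemma L1_limit_of_subseq:
  fixes f :: "nat \<Rightarrow> 'a \<Rightarrow> real"
  assumes int: "\<And>n. integrable M (f n)"
    and cauchy: "\<And>e. e > 0 \<Longrightarrow> \<exists>N. \<forall>i\<ge>N. \<forall>j\<ge>N. (LINT x|M. \<bar>f i x - f j x\<bar>) < e"
  obtains r G where "strict_mono r" "integrable M G" "AE x in M. (\<lambda>i. f (r i) x) \<longlonglongrightarrow> G x"
    "(\<lambda>i. LINT x|M. \<bar>f (r i) x - G x\<bar>) \<longlonglongrightarrow> 0"
proof -
  obtain r where r: "strict_mono r" and C: "AE x in M. Cauchy (\<lambda>i. f (r i) x)"
    using cauchy_L1_AE_cauchy_subseq[of M f] int cauchy by (auto simp: real_norm_def)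
  define G where "G x = lim (\<lambda>i. f (r i) x)" for x
  have [measurable]: "f n \<in> borel_measurable M" for n using int by auto
  have Gm [measurable]: "G \<in> borel_measurable M"
    unfolding G_def by measurable
  have conv: "AE x in M. (\<lambda>i. f (r i) x) \<longlonglongrightarrow> G x"
    using C by eventually_elim (simp add: G_def convergent_LIMSEQ_iff[symmetric] Cauchy_convergent_iff)
  have bound: "(\<integral>\<^sup>+x. ennreal \<bar>f (r i) x - G x\<bar> \<partial>M) \<le> ennreal e"
    if N: "\<And>i j. i \<ge> N \<Longrightarrow> j \<ge> N \<Longrightarrow> (LINT x|M. \<bar>f i x - f j x\<bar>) < e" and i: "i \<ge> N" and e: "e > 0" for N i e
  proof -
    have ri: "r j \<ge> N" if "j \<ge> N" for j using seq_suble[OF r, of j] that by simp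
    have "(\<integral>\<^sup>+x. ennreal \<bar>f (r i) x - G x\<bar> \<partial>M) = (\<integral>\<^sup>+x. liminf (\<lambda>j. ennreal \<bar>f (r i) x - f (r j) x\<bar>) \<partial>M)"
    proof (rule nn_integral_cong_AE)
      show "AE x in M. ennreal \<bar>f (r i) x - G x\<bar> = liminf (\<lambda>j. ennreal \<bar>f (r i) x - f (r j) x\<bar>)"
        using conv
      proof eventually_elim
        case (elim x)
        have "(\<lambda>j. ennreal \<bar>f (r i) x - f (r j) x\<bar>) \<longlonglongrightarrow> ennreal \<bar>f (r i) x - G x\<bar>"
          by (intro tendsto_ennrealI tendsto_intros elim)
        then show ?case by (intro lim_imp_Liminf[symmetric]) auto
      qed
    qed
    also have "\<dots> \<le> liminf (\<lambda>j. \<integral>\<^sup>+x. ennreal \<bar>f (r i) x - f (r j) x\<bar> \<partial>M)"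
      by (rule nn_integral_liminf) measurable
    also have "\<dots> \<le> ennreal e"
    proof (rule Liminf_le)
      show "\<forall>\<^sub>F j in sequentially. (\<integral>\<^sup>+x. ennreal \<bar>f (r i) x - f (r j) x\<bar> \<partial>M) \<le> ennreal e"
        using eventually_ge_at_top[of N]
      proof eventually_elim
        case (elim j)
        have "(\<integral>\<^sup>+x. ennreal \<bar>f (r i) x - f (r j) x\<bar> \<partial>M) = ennreal (LINT x|M. \<bar>f (r i) x - f (r j) x\<bar>)"
          using int by (intro nn_integral_eq_integral) auto
        also have "\<dots> \<le> ennreal e" using N[OF ri[OF i] ri[OF elim]] by (intro ennreal_leI) simp
        finally show ?case .
      qed
    qed simp
    finally show ?thesis .
  qed
  have iG: "integrable M G"
  proof -
    obtain N where N: "\<And>i j. i \<ge> N \<Longrightarrow> j \<ge> N \<Longrightarrow> (LINT x|M. \<bar>f i x - f j x\<bar>) < 1"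
      using cauchy[of 1] by auto
    have "integrable M (\<lambda>x. f (r N) x - G x)"
      unfolding integrable_iff_bounded using bound[OF N, of N] 
      by (auto intro: order_le_less_trans[of _ 1])
    from Bochner_Integration.integrable_diff[OF int[of "r N"] this] show ?thesis by simp
  qed
  have "(\<lambda>i. LINT x|M. \<bar>f (r i) x - G x\<bar>) \<longlonglongrightarrow> 0"
  proof (rule LIMSEQ_I)
    fix e :: real assume e: "e > 0"
    then obtain N where N: "\<And>i j. i \<ge> N \<Longrightarrow> j \<ge> N \<Longrightarrow> (LINT x|M. \<bar>f i x - f j x\<bar>) < e / 2"
      using cauchy[of "e / 2"] by auto
    have "norm ((LINT x|M. \<bar>f (r i) x - G x\<bar>) - 0) < e" if "i \<ge> N" for i
    proof -
      have "ennreal (LINT x|M. \<bar>f (r i) x - G x\<bar>) = (\<integral>\<^sup>+x. ennreal \<bar>f (r i) x - G x\<bar> \<partial>M)"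
        using int iG by (intro nn_integral_eq_integral[symmetric]) auto
      also have "\<dots> \<le> ennreal (e / 2)" using bound[OF N that] e by simp
      finally have "(LINT x|M. \<bar>f (r i) x - G x\<bar>) \<le> e / 2" using e by (subst (asm) ennreal_le_iff) auto
      moreover have "(LINT x|M. \<bar>f (r i) x - G x\<bar>) \<ge> 0" by (rule integral_nonneg_AE) simp
      ultimately show ?thesis using e by simp
    qed
    then show "\<exists>no. \<forall>n\<ge>no. norm ((LINT x|M. \<bar>f (r n) x - G x\<bar>) - 0) < e" by blast
  qed
  with that r iG conv show thesis by blast
qed

lemma convex_combinations_L1_converge:
  fixes f :: "nat \<Rightarrow> 'a \<Rightarrow> real"
  assumes meas: "\<And>j. f j \<in> borel_measurable M"
    and pos: "\<And>j x. f j x > 0"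
    and ie: "\<And>j. integrable M (\<lambda>x. ent (f j x))"
    and B: "\<And>j. (LINT x|M. ent (f j x)) \<le> B"
  obtains c G where "\<And>n. c n \<in> tail_weights n" "integrable M G"
    "AE x in M. (\<lambda>n. wsum (c n) (\<lambda>j. f j x)) \<longlonglongrightarrow> G x"
    "(\<lambda>n. LINT x|M. \<bar>wsum (c n) (\<lambda>j. f j x) - G x\<bar>) \<longlonglongrightarrow> 0"
proof -
  note [measurable] = meas
  define F where "F c x = wsum c (\<lambda>j. f j x)" for c x
  define L where "L c = (LINT x|M. ent (F c x))" for c
  have Fpos: "F c x > 0" if "c \<in> tail_weights n" for c n x
    unfolding F_def by (rule wsum_pos[OF that]) (rule pos)
  have Fm [measurable]: "F c \<in> borel_measurable M" for c
    unfolding F_def by (rule borel_measurable_wsum) measurable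
  have ent_le: "ent (F c x) \<le> wsum c (\<lambda>j. ent (f j x))" if "c \<in> tail_weights n" for c n x
    unfolding F_def by (rule wsum_convex[OF that convex_on_ent]) (simp add: pos)
  have ent_nonneg: "ent v \<ge> 0" if "v > 0" for v using ent_ge[OF that] that by simp
  have iF: "integrable M (\<lambda>x. ent (F c x))" if "c \<in> tail_weights n" for c n
  proof (rule Bochner_Integration.integrable_bound[OF integral_wsum(1)[OF ie]])
    show "AE x in M. norm (ent (F c x)) \<le> norm (wsum c (\<lambda>j. ent (f j x)))"
    proof (rule AE_I2)
      fix x
      show "norm (ent (F c x)) \<le> norm (wsum c (\<lambda>j. ent (f j x)))"
        using ent_le[OF that, of x] ent_nonneg[OF Fpos[OF that], of x] by simp
    qed
  qed measurable
  have LB: "L c \<le> B" if "c \<in> tail_weights n" for c n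
  proof -
    have "L c \<le> (LINT x|M. wsum c (\<lambda>j. ent (f j x)))"
      unfolding L_def by (rule integral_mono[OF iF[OF that] integral_wsum(1)[OF ie] ent_le[OF that]])
    also have "\<dots> = wsum c (\<lambda>j. LINT x|M. ent (f j x))" by (rule integral_wsum(2)[OF ie])
    also have "\<dots> \<le> wsum c (\<lambda>j. B)" by (rule wsum_mono[OF that B])
    also have "\<dots> = B" by (rule wsum_const[OF that])
    finally show ?thesis .
  qed
  have L0: "L c \<ge> 0" if "c \<in> tail_weights n" for c n
    unfolding L_def by (rule integral_nonneg_AE, rule AE_I2) (rule ent_nonneg[OF Fpos[OF that]])
  have intF: "integrable M (F c)" if "c \<in> tail_weights n" for c n
    by (rule Bochner_Integration.integrable_bound[OF iF[OF that]])
       (use Fpos[OF that] ent_ge ent_nonneg in \<open>auto intro!: AE_I2 simp: less_imp_le\<close>)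
  have intF_le: "(LINT x|M. F c x) \<le> B" if "c \<in> tail_weights n" for c n
  proof -
    have "(LINT x|M. F c x) \<le> L c"
      unfolding L_def by (rule integral_mono[OF intF[OF that] iF[OF that]]) (rule ent_ge[OF Fpos[OF that]])
    then show ?thesis using LB[OF that] by simp
  qed
  have B0: "B \<ge> 0" using L0[OF tail_weights_nonempty] LB[OF tail_weights_nonempty] by (rule order_trans)
  \<comment> \<open>The classes shrink with n, so these minimal entropies increase; bounded by
    \<open>B\<close>, they converge. This makes near-minimizers for different n comparable.\<close>
  define m where "m n = Inf (L ` tail_weights n)" for n
  have bdd: "bdd_below (L ` tail_weights n)" for n using L0 by (intro bdd_belowI2[where m=0]) 
  have ne: "L ` tail_weights n \<noteq> {}" for n using tail_weights_nonempty by auto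
  have m_le: "m n \<le> L c" if "c \<in> tail_weights n" for n c
    unfolding m_def by (rule cInf_lower[OF _ bdd]) (use that in auto)
  have m_mono: "m n \<le> m k" if "n \<le> k" for n k
    unfolding m_def by (rule cInf_superset_mono[OF ne bdd]) (use tail_weights_antimono[OF that] in auto)
  have m_B: "m n \<le> B" for n using m_le[OF tail_weights_nonempty] LB[OF tail_weights_nonempty] by (rule order_trans)
  have "\<exists>c. c \<in> tail_weights n \<and> L c < m n + 1 / real (Suc n)" for n
    using cInf_lessD[OF ne, of n "m n + 1 / real (Suc n)"] unfolding m_def by auto
  then obtain c where c: "\<And>n. c n \<in> tail_weights n" and Lc: "\<And>n. L (c n) < m n + 1 / real (Suc n)" by metis
  have conv_m: "convergent m"
    by (rule Bseq_mono_convergent) 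
       (use m_mono m_B m_mono[of 0] in \<open>auto intro!: BseqI'[of _ "\<bar>m 0\<bar> + \<bar>B\<bar>"] simp: abs_le_iff, (smt (verit) m_mono m_B le0)+\<close>)
  then obtain mi where mi: "m \<longlonglongrightarrow> mi" by (auto simp: convergent_def)
  have m_mi: "m n \<le> mi" for n
    using mi m_mono by (intro incseq_le) (auto simp: incseq_def)
  \<comment> \<open>For i, j >= k the midpoint of the two near-minimizers competes in the k-th
    class, so its entropy is at least \<open>m k\<close>. The deficit is thus at most twice the gap
    \<open>mi - m k\<close> plus the errors of near-minimality.\<close>
  have key: "(LINT x|M. \<bar>F (c i) x - F (c j) x\<bar>) \<le> (2 * (mi - m k) + 2 / real (Suc k)) / \<eta> + \<eta> * (2 * B)"
    if ij: "k \<le> i" "k \<le> j" and \<eta>: "\<eta> > 0" for i j k \<eta>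
  proof -
    let ?d = "\<lambda>l. (c i l + c j l) / 2"
    have ck: "c i \<in> tail_weights k" "c j \<in> tail_weights k" using c tail_weights_antimono ij by blast+
    note mid = tail_weights_midpoint[OF ck]
    have Fmid: "F ?d x = (F (c i) x + F (c j) x) / 2" for x unfolding F_def by (rule mid)
    note ints = iF[OF ck(1)] iF[OF ck(2)] iF[OF mid(1)] intF[OF ck(1)] intF[OF ck(2)]
    have "(LINT x|M. \<bar>F (c i) x - F (c j) x\<bar>) \<le> 
      (LINT x|M. (ent (F (c i) x) + ent (F (c j) x) - 2 * ent (F ?d x)) / \<eta> + \<eta> * (F (c i) x + F (c j) x))"
      unfolding Fmid
      by (rule integral_mono[OF _ _ entropy_midpoint_deficit[OF Fpos[OF ck(1)] Fpos[OF ck(2)] \<eta>]])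
         (use ints[unfolded Fmid] in auto)
    also have "\<dots> = (L (c i) + L (c j) - 2 * L ?d) / \<eta> + \<eta> * ((LINT x|M. F (c i) x) + (LINT x|M. F (c j) x))"
      unfolding L_def using ints by simp
    also have "\<dots> \<le> (2 * (mi - m k) + 2 / real (Suc k)) / \<eta> + \<eta> * (2 * B)"
    proof (intro add_mono divide_right_mono mult_left_mono)
      have h: "L (c l) \<le> mi + 1 / real (Suc k)" if "k \<le> l" for l
      proof -
        have "1 / real (Suc l) \<le> 1 / real (Suc k)" using that by (intro divide_left_mono) auto
        then show ?thesis using Lc[of l] m_mi[of l] by linarith
      qed
      show "L (c i) + L (c j) - 2 * L ?d \<le> 2 * (mi - m k) + 2 / real (Suc k)"
        using h[OF ij(1)] h[OF ij(2)] m_le[OF mid(1)] by (simp add: algebra_simps)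
      show "(LINT x|M. F (c i) x) + (LINT x|M. F (c j) x) \<le> 2 * B"
        using intF_le[OF ck(1)] intF_le[OF ck(2)] by simp
    qed (use \<eta> in auto)
    finally show ?thesis .
  qed
  have cau: "\<exists>N. \<forall>i\<ge>N. \<forall>j\<ge>N. (LINT x|M. \<bar>F (c i) x - F (c j) x\<bar>) < e" if "e > 0" for e
  proof -
    \<comment> \<open>First \<open>\<eta>\<close> makes the mass term smaller than e / 2 uniformly
      in k, then k is taken large. The 1 in B + 1 avoids a zero denominator.\<close>
    define \<eta> where "\<eta> = e / (4 * (B + 1))"
    have \<eta>: "\<eta> > 0" using that B0 by (simp add: \<eta>_def)
    have small: "\<eta> * (2 * B) < e / 2" using that B0 by (simp add: \<eta>_def field_simps)
    have "(\<lambda>k. (2 * (mi - m k) + 2 * inverse (real (Suc k))) / \<eta>) \<longlonglongrightarrow> (2 * (mi - mi) + 2 * 0) / \<eta>"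
      by (intro tendsto_intros mi LIMSEQ_inverse_real_of_nat) (use \<eta> in simp)
    then have "(\<lambda>k. (2 * (mi - m k) + 2 / real (Suc k)) / \<eta>) \<longlonglongrightarrow> 0"
      by (simp add: divide_inverse)
    from order_tendstoD(2)[OF this, of "e / 2"] that
    obtain k where k: "(2 * (mi - m k) + 2 / real (Suc k)) / \<eta> < e / 2"
      by (auto simp: eventually_sequentially)
    have "(LINT x|M. \<bar>F (c i) x - F (c j) x\<bar>) < e" if "k \<le> i" "k \<le> j" for i j
      using key[OF that \<eta>] k small by linarith
    then show ?thesis by blast
  qed
  obtain r G where r: "strict_mono r" and G: "integrable M G" "AE x in M. (\<lambda>i. F (c (r i)) x) \<longlonglongrightarrow> G x"
    "(\<lambda>i. LINT x|M. \<bar>F (c (r i)) x - G x\<bar>) \<longlonglongrightarrow> 0"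
    by (rule L1_limit_of_subseq[of M "\<lambda>n. F (c n)"]) (use intF[OF c] cau in auto)
  \<comment> \<open>Since r n >= n, the weights remain forward along the subsequence.\<close>
  have "c (r n) \<in> tail_weights n" for n using c[of "r n"] tail_weights_antimono seq_suble[OF r, of n] by blast
  from that[of "\<lambda>n. c (r n)", OF this G[unfolded F_def]] show thesis .
qed

section \<open>Separately convex functions\<close>

lemma convex_on_transfer:
  assumes "convex_on S f" "\<And>x. x \<in> S \<Longrightarrow> f x = g x"
  shows "convex_on S g"
  using assms unfolding convex_on_def by (metis (no_types, lifting) convexD)

lemma convex_three_points:
  fixes f :: "real \<Rightarrow> real"
  assumes f: "convex_on S f" "a \<in> S" "c \<in> S" and abc: "a < b" "b < c"
  shows "f b * (c - a) \<le> f a * (c - b) + f c * (b - a)"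
proof -
  define t where "t = (b - a) / (c - a)"
  have t: "0 \<le> t" "t \<le> 1" using abc by (auto simp: t_def)
  have tc: "t * (c - a) = b - a" using abc by (simp add: t_def)
  have b: "(1 - t) *\<^sub>R a + t *\<^sub>R c = b" using tc by (simp add: algebra_simps)
  have "f b \<le> (1 - t) * f a + t * f c"
    using convex_onD[OF f(1) t f(2,3)] unfolding b .
  then have "f b * (c - a) \<le> ((1 - t) * f a + t * f c) * (c - a)"
    using abc by (intro mult_right_mono) auto
  also have "\<dots> = f a * (c - b) + f c * (b - a)"
    using tc by algebra
  finally show ?thesis .
qed

text \<open>A substitute for the supporting line at v: the slope is a forward difference quotient,
  and the second difference pays for the error. Unlike subgradients, both pass to pointwise limits
  of functions.\<close>

lemma convex_secant_lower:
  fixes f :: "real \<Rightarrow> real"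
  assumes f: "convex_on {0<..} f" and v: "0 < e" "e < v" and x: "0 < x"
  shows "f x \<ge> f v + (f (v + e) - f v) / e * (x - v) - (f (v + e) - 2 * f v + f (v - e))"
proof -
  define q E where "q = (f (v + e) - f v) / e" and "E = f (v + e) - 2 * f v + f (v - e)"
  have q: "e * q = f (v + e) - f v" using v by (simp add: q_def)
  have "f v * (v + e - (v - e)) \<le> f (v - e) * (v + e - v) + f (v + e) * (v - (v - e))"
    by (rule convex_three_points[OF f]) (use v in auto)
  then have "0 \<le> e * E" by (simp add: E_def algebra_simps)
  then have E: "0 \<le> E" using v by (simp add: zero_le_mult_iff)
  have "e * (f v + q * (x - v) - E) \<le> e * f x"
  proof -
    consider "x < v" | "x = v" | "v < x" "x < v + e" | "x = v + e" | "v + e < x" by linarith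
    then show ?thesis
    proof cases
      case 1
      have "f v * (v + e - x) \<le> f x * (v + e - v) + f (v + e) * (v - x)"
        by (rule convex_three_points[OF f]) (use v x 1 in auto)
      moreover have "e * (q * (x - v)) = (f (v + e) - f v) * (x - v)" using q by (simp add: mult.assoc[symmetric])
      ultimately show ?thesis using \<open>0 \<le> e * E\<close> by (simp add: algebra_simps)
    next
      case 2
      then show ?thesis using E v by simp
    next
      \<comment> \<open>Only here can the secant through v and v + e lie above the graph, so the
        left point v - e is brought in and the error term is spent.\<close>
      case 3
      have "f v * (x - (v - e)) \<le> f (v - e) * (x - v) + f x * (v - (v - e))"
        by (rule convex_three_points[OF f]) (use v x 3 in auto)
      moreover have "e * (q * (x - v)) = (f (v + e) - f v) * (x - v)" using q by (simp add: mult.assoc[symmetric])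
      moreover have "(x - v) * E \<le> e * E" using 3 E by (intro mult_right_mono) auto
      moreover have "(f (v + e) - f v) * (x - v) = (f v - f (v - e)) * (x - v) + (x - v) * E"
        by (simp add: E_def algebra_simps)
      ultimately show ?thesis by (simp add: algebra_simps)
    next
      case 4
      then show ?thesis using E v q by (simp add: algebra_simps)
    next
      case 5
      have "f (v + e) * (x - v) \<le> f v * (x - (v + e)) + f x * (v + e - v)"
        by (rule convex_three_points[OF f]) (use v x 5 in auto)
      moreover have "e * (q * (x - v)) = (f (v + e) - f v) * (x - v)" using q by (simp add: mult.assoc[symmetric])
      ultimately show ?thesis using \<open>0 \<le> e * E\<close> by (simp add: algebra_simps)
    qed
  qed
  then have "f v + q * (x - v) - E \<le> f x" using v by simp
  then show ?thesis by (simp add: q_def E_def)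
qed

text \<open>Only the averages of \<open>g\<close> converge; single terms may be far from
  \<open>v\<close>. The secant bound at \<open>v\<close> is affine in \<open>g j\<close>, so it
  survives averaging once its slope is frozen at \<open>q0\<close>. The slope error is multiplied by
  at most g j + v, whose averages stay bounded. The increment e is fixed beforehand by continuity of
  \<open>flim\<close>.\<close>

lemma convex_averages_lower:
  fixes f :: "nat \<Rightarrow> real \<Rightarrow> real"
  assumes c: "\<And>n. c n \<in> tail_weights n"
    and fj: "\<And>j. convex_on {0<..} (f j)" and flim: "convex_on {0<..} flim"
    and lim: "\<And>x. x > 0 \<Longrightarrow> (\<lambda>j. f j x) \<longlonglongrightarrow> flim x"
    and g: "\<And>j. g j > 0" and v: "v > 0" and gv: "(\<lambda>n. wsum (c n) g) \<longlonglongrightarrow> v"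
    and a: "a < flim v"
  shows "\<forall>\<^sub>F n in sequentially. a < wsum (c n) (\<lambda>j. f j (g j))"
proof -
  define d where "d = flim v - a"
  have d: "d > 0" using a by (simp add: d_def)
  have "continuous_on {0<..} flim" by (rule convex_on_continuous[OF _ flim]) simp
  then have cont: "isCont flim v" using v by (simp add: continuous_on_eq_continuous_at)
  have "((\<lambda>e. flim (v + e) - 2 * flim v + flim (v - e)) \<longlongrightarrow> flim v - 2 * flim v + flim v) (at_right 0)"
  proof (intro tendsto_intros isCont_tendsto_compose[OF cont])
    show "((+) v \<longlongrightarrow> v) (at_right 0)" "((-) v \<longlongrightarrow> v) (at_right 0)"
      by (auto intro!: tendsto_eq_intros)
  qed
  then have "((\<lambda>e. flim (v + e) - 2 * flim v + flim (v - e)) \<longlongrightarrow> 0) (at_right 0)" by simp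
  then have "\<forall>\<^sub>F e in at_right 0. flim (v + e) - 2 * flim v + flim (v - e) < d / 2"
    by (rule order_tendstoD(2)) (use d in simp)
  moreover have "\<forall>\<^sub>F e in at_right 0. e \<in> {0<..<v}" using v by (rule eventually_at_right_real)
  ultimately have "\<forall>\<^sub>F e in at_right 0. flim (v + e) - 2 * flim v + flim (v - e) < d / 2 \<and> e \<in> {0<..<v}"
    by (rule eventually_conj)
  from eventually_happens'[OF _ this] obtain e where e: "0 < e" "e < v" "flim (v + e) - 2 * flim v + flim (v - e) < d / 2"
    by auto
  define q0 q where "q0 = (flim (v + e) - flim v) / e" and "q j = (f j (v + e) - f j v) / e" for j
  define E where "E j = f j (v + e) - 2 * f j v + f j (v - e)" for j
  \<comment> \<open>In the limit the slope errors cost \<open>\<eta> * (v + v)\<close> = d / 4 and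
    the second difference less than d / 2, so part of the margin d remains.\<close>
  define \<eta> where "\<eta> = d / (8 * v)"
  have \<eta>: "\<eta> > 0" using d v by (simp add: \<eta>_def)
  have "q \<longlonglongrightarrow> q0" unfolding q_def q0_def
    by (intro tendsto_intros lim) (use e v in auto)
  then obtain N where N: "\<And>j. j \<ge> N \<Longrightarrow> \<bar>q j - q0\<bar> < \<eta>"
    using LIMSEQ_D[OF _ \<eta>] by (metis real_norm_def)
  define b where "b j = f j v - E j" for j
  have b: "b \<longlonglongrightarrow> flim v - (flim (v + e) - 2 * flim v + flim (v - e))"
    unfolding b_def E_def by (intro tendsto_intros lim) (use e v in auto)
  have lower: "wsum (c n) b + q0 * (wsum (c n) g - v) - \<eta> * (wsum (c n) g + v) \<le> wsum (c n) (\<lambda>j. f j (g j))"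
    if "n \<ge> N" for n
  proof -
    have "wsum (c n) (\<lambda>j. b j + (q0 * (g j - v) - \<eta> * (g j + v))) \<le> wsum (c n) (\<lambda>j. f j (g j))"
    proof (rule wsum_mono[OF c])
      fix j assume "j \<ge> n"
      then have "\<bar>q j - q0\<bar> * \<bar>g j - v\<bar> \<le> \<eta> * (g j + v)"
        using N[of j] that g[of j] v by (intro mult_mono) auto
      then have "- (\<eta> * (g j + v)) \<le> (q j - q0) * (g j - v)" 
        unfolding abs_mult[symmetric] by linarith
      moreover have "f j (g j) \<ge> b j + q j * (g j - v)"
        using convex_secant_lower[OF fj[of j] e(1,2) g[of j]] by (simp add: b_def E_def q_def)
      ultimately show "b j + (q0 * (g j - v) - \<eta> * (g j + v)) \<le> f j (g j)" by (simp add: algebra_simps)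
    qed
    also have "wsum (c n) (\<lambda>j. b j + (q0 * (g j - v) - \<eta> * (g j + v))) = 
        wsum (c n) b + (q0 * (wsum (c n) g - v) - \<eta> * (wsum (c n) g + v))"
      by (simp add: wsum_add wsum_diff wsum_cmult wsum_const[OF c])
    finally show ?thesis by simp
  qed
  have "(\<lambda>n. wsum (c n) b + q0 * (wsum (c n) g - v) - \<eta> * (wsum (c n) g + v)) \<longlonglongrightarrow> 
     (flim v - (flim (v + e) - 2 * flim v + flim (v - e))) + q0 * (v - v) - \<eta> * (v + v)"
    by (intro tendsto_intros wsum_tendsto[OF c b] gv)
  moreover have "a < (flim v - (flim (v + e) - 2 * flim v + flim (v - e))) + q0 * (v - v) - \<eta> * (v + v)"
  proof -
    have "\<eta> * (v + v) = d / 4" using v by (simp add: \<eta>_def)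
    then show ?thesis using e(3) d d_def by (simp add: algebra_simps)
  qed
  ultimately have "\<forall>\<^sub>F n in sequentially. a < wsum (c n) b + q0 * (wsum (c n) g - v) - \<eta> * (wsum (c n) g + v)"
    by (rule order_tendstoD(1))
  then show ?thesis
    using eventually_ge_at_top[of N] by eventually_elim (use lower in force)
qed

text \<open>The function 1/x lies above its tangent at any t > 0, so the averages of k / g j are
  asymptotically at least 2 k / t, and t is arbitrary.\<close>

lemma averages_blow_up:
  assumes c: "\<And>n. c n \<in> tail_weights n" and g: "\<And>j. g j > 0" and g0: "(\<lambda>n. wsum (c n) g) \<longlonglongrightarrow> 0"
    and k: "k > 0" and a: "\<And>j. a j \<ge> k / g j - b"
  shows "\<forall>\<^sub>F n in sequentially. A < wsum (c n) a"
proof -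
  \<comment> \<open>With this t the tangent bound tends to 2 (|A| + |b| + 1) - b, which exceeds
    A.\<close>
  define t where "t = k / (\<bar>A\<bar> + \<bar>b\<bar> + 1)"
  have t: "t > 0" using k by (simp add: t_def)
  have "k * (2 / t) - b > A"
  proof -
    have "k * (2 / t) = 2 * (\<bar>A\<bar> + \<bar>b\<bar> + 1)" using k by (simp add: t_def)
    then show ?thesis 
      using abs_ge_self[of A] abs_ge_self[of b] abs_ge_zero[of A] abs_ge_zero[of b] by argo
  qed
  then have t2: "A < k * (2 / t - 0 / t\<^sup>2) - b" by simp
  have lower: "k * (2 / t - wsum (c n) g / t\<^sup>2) - b \<le> wsum (c n) a" for n
  proof -
    have "wsum (c n) (\<lambda>j. k * (2 / t - (1 / t\<^sup>2) * g j) - b) \<le> wsum (c n) a"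
    proof (rule wsum_mono[OF c])
      fix j
      have "0 \<le> (g j - t)\<^sup>2 / (t\<^sup>2 * g j)" using g[of j] by simp
      also have "\<dots> = 1 / g j - (2 / t - (1 / t\<^sup>2) * g j)"
        using g[of j] t by (simp add: field_simps power2_eq_square)
      finally have "k * (2 / t - (1 / t\<^sup>2) * g j) \<le> k * (1 / g j)" using k by (intro mult_left_mono) auto
      then show "k * (2 / t - (1 / t\<^sup>2) * g j) - b \<le> a j" using a[of j] by simp
    qed
    then show ?thesis unfolding wsum_diff wsum_cmult wsum_const[OF c] by simp
  qed
  have "(\<lambda>n. k * (2 / t - wsum (c n) g / t\<^sup>2) - b) \<longlonglongrightarrow> k * (2 / t - 0 / t\<^sup>2) - b"
    by (intro tendsto_intros g0) (use t in auto)
  from order_tendstoD(1)[OF this t2] show ?thesis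
    by eventually_elim (use lower in \<open>auto intro: less_le_trans\<close>)
qed

section \<open>From separate convexity to joint continuity\<close>

lemma convex_nonneg_le_endpoints:
  fixes f :: "real \<Rightarrow> real"
  assumes f: "convex_on {0<..} f" and nn: "\<And>x. x > 0 \<Longrightarrow> f x \<ge> 0" and p: "0 < p" and x: "p \<le> x" "x \<le> q"
  shows "f x \<le> f p + f q"
proof (cases "x = p \<or> x = q")
  case True
  then show ?thesis using nn[of p] nn[of q] p x by auto
next
  case False
  then have pq: "p < x" "x < q" using x by auto
  have "f x * (q - p) \<le> f p * (q - x) + f q * (x - p)"
    by (rule convex_three_points[OF f]) (use pq p in auto)
  also have "\<dots> \<le> f p * (q - p) + f q * (q - p)"
    using pq p nn by (intro add_mono mult_left_mono) auto
  finally have "f x * (q - p) \<le> (f p + f q) * (q - p)" by (simp add: algebra_simps)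
  then show ?thesis using pq by simp
qed

text \<open>A secant slope of a convex function is bounded by the slopes over the adjacent intervals
  of length a / 2 on either side, where the values lie between 0 and M.\<close>

lemma convex_nonneg_Lipschitz:
  fixes f :: "real \<Rightarrow> real"
  assumes f: "convex_on {0<..} f" and nn: "\<And>x. x > 0 \<Longrightarrow> f x \<ge> 0"
    and M: "\<And>x. a / 2 \<le> x \<Longrightarrow> x \<le> b + a / 2 \<Longrightarrow> f x \<le> M"
    and a: "0 < a" and x: "a \<le> x" "x \<le> b" and y: "a \<le> y" "y \<le> b"
  shows "\<bar>f x - f y\<bar> \<le> 2 * M / a * \<bar>x - y\<bar>"
proof -
  have *: "\<bar>f x - f y\<bar> * a \<le> 2 * M * \<bar>x - y\<bar>" if x: "a \<le> x" and y: "y \<le> b" and xy: "x < y" for x y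
  proof -
    have "f y * (y + a / 2 - x) \<le> f x * (y + a / 2 - y) + f (y + a / 2) * (y - x)"
      by (rule convex_three_points[OF f]) (use a x xy in auto)
    moreover have "f (y + a / 2) * (y - x) \<le> M * (y - x)"
      using M[of "y + a / 2"] a x y xy by (intro mult_right_mono) auto
    moreover have "0 \<le> f y * (y - x)" using nn[of y] a x xy by simp
    ultimately have 1: "(f y - f x) * a \<le> 2 * M * (y - x)" by (simp add: algebra_simps)
    have "f x * (y - (x - a / 2)) \<le> f (x - a / 2) * (y - x) + f y * (x - (x - a / 2))"
      by (rule convex_three_points[OF f]) (use a x xy in auto)
    moreover have "f (x - a / 2) * (y - x) \<le> M * (y - x)"
      using M[of "x - a / 2"] a x y xy by (intro mult_right_mono) auto
    moreover have "0 \<le> f x * (y - x)" using nn[of x] a x xy by simp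
    ultimately have 2: "(f x - f y) * a \<le> 2 * M * (y - x)" by (simp add: algebra_simps)
    show ?thesis using 1 2 xy by (cases "f x \<le> f y") (auto simp: abs_if)
  qed
  have "\<bar>f x - f y\<bar> * a \<le> 2 * M * \<bar>x - y\<bar>"
    using *[of x y] *[of y x] x y by (cases x y rule: linorder_cases) (auto simp: abs_minus_commute)
  then show ?thesis using a by (simp add: field_simps)
qed

text \<open>The values at the eight corners of a cube bound \<open>f\<close> on the cube. This gives
  one Lipschitz constant for all three variables, and the coordinates are then changed one at a
  time.\<close>

lemma separately_convex_tendsto:
  fixes f :: "real \<Rightarrow> real \<Rightarrow> real \<Rightarrow> real"
  assumes nn: "\<And>x y z. x > 0 \<Longrightarrow> y > 0 \<Longrightarrow> z > 0 \<Longrightarrow> f x y z \<ge> 0"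
    and c1: "\<And>y z. y > 0 \<Longrightarrow> z > 0 \<Longrightarrow> convex_on {0<..} (\<lambda>x. f x y z)"
    and c2: "\<And>x z. x > 0 \<Longrightarrow> z > 0 \<Longrightarrow> convex_on {0<..} (\<lambda>y. f x y z)"
    and c3: "\<And>x y. x > 0 \<Longrightarrow> y > 0 \<Longrightarrow> convex_on {0<..} (\<lambda>z. f x y z)"
    and lim: "X \<longlonglongrightarrow> x" "Y \<longlonglongrightarrow> y" "Z \<longlonglongrightarrow> z" and pos: "x > 0" "y > 0" "z > 0"
  shows "(\<lambda>n::nat. f (X n) (Y n) (Z n)) \<longlonglongrightarrow> f x y z"
proof -
  \<comment> \<open>The limits lie inside [a, b]; [p, q] is wider by a / 2 on both sides, the room
    required by \<open>convex_nonneg_Lipschitz\<close>.\<close>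
  define a b where "a = min x (min y z) / 2" and "b = max x (max y z) + 1"
  define p q where "p = a / 2" and "q = b + a / 2"
  have a: "a > 0" and ab: "a < x" "a < y" "a < z" "x < b" "y < b" "z < b"
    using pos by (auto simp: a_def b_def)
  have p: "p > 0" and q: "q > 0" using a ab pos by (auto simp: p_def q_def)
  define M where "M = f p p p + f q p p + (f p q p + f q q p) + (f p p q + f q p q + (f p q q + f q q q))"
  have M: "f u v w \<le> M" if "u \<in> {p..q}" "v \<in> {p..q}" "w \<in> {p..q}" for u v w
  proof -
    have s1: "f u v w \<le> f p v w + f q v w" if "u \<in> {p..q}" "v > 0" "w > 0" for u v w
      using convex_nonneg_le_endpoints[OF c1[OF that(2,3)] nn p, of u q] that by auto
    have s2: "f u v w \<le> f u p w + f u q w" if "v \<in> {p..q}" "u > 0" "w > 0" for u v w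
      using convex_nonneg_le_endpoints[OF c2[OF that(2,3)] nn p, of v q] that by auto
    have s3: "f u v w \<le> f u v p + f u v q" if "w \<in> {p..q}" "u > 0" "v > 0" for u v w
      using convex_nonneg_le_endpoints[OF c3[OF that(2,3)] nn p, of w q] that by auto
    have uvw: "u > 0" "v > 0" "w > 0" using that p by auto
    have "f u v w \<le> f u v p + f u v q" using s3 that uvw by simp
    also have "f u v p \<le> f u p p + f u q p" using s2 that uvw p by simp
    also have "f u v q \<le> f u p q + f u q q" using s2 that uvw q by simp
    also have "f u p p \<le> f p p p + f q p p" using s1 that p q by simp
    also have "f u q p \<le> f p q p + f q q p" using s1 that p q by simp
    also have "f u p q \<le> f p p q + f q p q" using s1 that p q by simp
    also have "f u q q \<le> f p q q + f q q q" using s1 that p q by simp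
    finally show ?thesis by (simp add: M_def)
  qed
  have I: "{a..b} \<subseteq> {p..q}" using a by (auto simp: p_def q_def)
  define L where "L = 2 * M / a"
  have ev: "\<forall>\<^sub>F n in sequentially. W n \<in> {a..b}" if "W \<longlonglongrightarrow> w" "a < w" "w < b" for W :: "nat \<Rightarrow> real" and w
    using order_tendstoD(1)[OF that(1,2)] order_tendstoD(2)[OF that(1,3)] by eventually_elim auto
  have bound: "\<forall>\<^sub>F n in sequentially. norm (f (X n) (Y n) (Z n) - f x y z) \<le> 
      L * (\<bar>X n - x\<bar> + \<bar>Y n - y\<bar> + \<bar>Z n - z\<bar>)"
    using ev[OF lim(1) ab(1,4)] ev[OF lim(2) ab(2,5)] ev[OF lim(3) ab(3,6)]
  proof eventually_elim
    case (elim n)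
    note XYZ = this
    have xyz: "x \<in> {a..b}" "y \<in> {a..b}" "z \<in> {a..b}" using ab by auto
    have po: "t > 0" if "t \<in> {a..b}" for t using that a by auto
    have 1: "\<bar>f (X n) (Y n) (Z n) - f x (Y n) (Z n)\<bar> \<le> L * \<bar>X n - x\<bar>"
      unfolding L_def
      by (rule convex_nonneg_Lipschitz[OF c1[OF po po] nn[OF _ po po] M, where b=b])
         (use XYZ xyz a I in \<open>auto simp: p_def q_def\<close>)
    have 2: "\<bar>f x (Y n) (Z n) - f x y (Z n)\<bar> \<le> L * \<bar>Y n - y\<bar>"
      unfolding L_def
      by (rule convex_nonneg_Lipschitz[OF c2[OF po po] nn[OF po _ po] M, where b=b])
         (use XYZ xyz a I in \<open>auto simp: p_def q_def\<close>)
    have 3: "\<bar>f x y (Z n) - f x y z\<bar> \<le> L * \<bar>Z n - z\<bar>"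
      unfolding L_def
      by (rule convex_nonneg_Lipschitz[OF c3[OF po po] nn[OF po po] M, where b=b])
         (use XYZ xyz a I in \<open>auto simp: p_def q_def\<close>)
    have "\<bar>f (X n) (Y n) (Z n) - f x y z\<bar> \<le> L * \<bar>X n - x\<bar> + L * \<bar>Y n - y\<bar> + L * \<bar>Z n - z\<bar>"
      using 1 2 3 by linarith
    then show ?case by (simp add: distrib_left)
  qed
  have "(\<lambda>n. L * (\<bar>X n - x\<bar> + \<bar>Y n - y\<bar> + \<bar>Z n - z\<bar>)) \<longlonglongrightarrow> L * (\<bar>x - x\<bar> + \<bar>y - y\<bar> + \<bar>z - z\<bar>)"
    by (intro tendsto_intros lim)
  then have "(\<lambda>n. L * (\<bar>X n - x\<bar> + \<bar>Y n - y\<bar> + \<bar>Z n - z\<bar>)) \<longlonglongrightarrow> 0" by simp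
  then show ?thesis
    by (subst Lim_null) (rule Lim_null_comparison[OF bound])
qed

section \<open>Measurability of compositions\<close>

lemma grid_tendsto: "(\<lambda>n. (of_int \<lfloor>real (Suc n) * x\<rfloor> + 1) / real (Suc n)) \<longlonglongrightarrow> x"
proof (rule Lim_null[THEN iffD2], rule Lim_null_comparison)
  show "\<forall>\<^sub>F n in sequentially. norm ((of_int \<lfloor>real (Suc n) * x\<rfloor> + 1) / real (Suc n) - x) \<le> inverse (real (Suc n))"
  proof (rule always_eventually, rule allI)
    fix n
    have "(of_int \<lfloor>real (Suc n) * x\<rfloor> + 1) / real (Suc n) - x = (of_int \<lfloor>real (Suc n) * x\<rfloor> + 1 - real (Suc n) * x) / real (Suc n)"
      by (simp add: field_simps)
    moreover have "\<bar>of_int \<lfloor>real (Suc n) * x\<rfloor> + 1 - real (Suc n) * x\<bar> \<le> 1" by linarith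
    ultimately show "norm ((of_int \<lfloor>real (Suc n) * x\<rfloor> + 1) / real (Suc n) - x) \<le> inverse (real (Suc n))"
      by (simp add: abs_divide divide_inverse mult_le_cancel_right1 del: of_nat_Suc)
  qed
qed (rule LIMSEQ_inverse_real_of_nat)

text \<open>The arguments are rounded to a grid of mesh 1 / (n + 1). For fixed n countably many grid
  points occur, so the rounded composition is measurable; continuity gives the limit.\<close>

lemma borel_measurable_Caratheodory:
  fixes f :: "'a \<Rightarrow> real \<Rightarrow> real \<Rightarrow> real \<Rightarrow> real"
  assumes meas: "\<And>x y z. x > 0 \<Longrightarrow> y > 0 \<Longrightarrow> z > 0 \<Longrightarrow> (\<lambda>R. f R x y z) \<in> borel_measurable M"
    and cont: "\<And>R X Y Z x y z. R \<in> space M \<Longrightarrow> X \<longlonglongrightarrow> x \<Longrightarrow> Y \<longlonglongrightarrow> y \<Longrightarrow> Z \<longlonglongrightarrow> z \<Longrightarrow> 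
       x > 0 \<Longrightarrow> y > 0 \<Longrightarrow> z > 0 \<Longrightarrow> (\<lambda>n::nat. f R (X n) (Y n) (Z n)) \<longlonglongrightarrow> f R x y z"
    and u [measurable]: "u \<in> borel_measurable M" "v \<in> borel_measurable M" "w \<in> borel_measurable M"
    and pos: "\<And>R. R \<in> space M \<Longrightarrow> u R > 0 \<and> v R > 0 \<and> w R > 0"
  shows "(\<lambda>R. f R (u R) (v R) (w R)) \<in> borel_measurable M"
proof -
  \<comment> \<open>Adding 1 after rounding down keeps the grid points of positive arguments
    positive, even when the floor is 0.\<close>
  define s where "s n i = (of_int i + 1) / real (Suc n)" for n :: nat and i :: int
  \<comment> \<open>The default 0 is never taken along \<open>h\<close> on the space; it makes every
    member of the countable family measurable.\<close>
  define F where "F n = (\<lambda>(i, j, k) R. if i \<ge> 0 \<and> j \<ge> 0 \<and> k \<ge> 0 then f R (s n i) (s n j) (s n k) else 0)" 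
    for n :: nat
  have spos: "s n i > 0" if "i \<ge> 0" for n i using that by (auto simp: s_def intro!: divide_pos_pos)
  have Fm: "F n ijk \<in> borel_measurable M" for n ijk
  proof -
    obtain i j k where ijk: "ijk = (i, j, k)" by (cases ijk)
    show ?thesis
    proof (cases "i \<ge> 0 \<and> j \<ge> 0 \<and> k \<ge> 0")
      case True
      then show ?thesis unfolding F_def ijk prod.case by (simp add: meas spos)
    next
      case False
      then show ?thesis unfolding F_def ijk prod.case if_not_P[OF False] by simp
    qed
  qed
  define h where "h n R = (\<lfloor>real (Suc n) * u R\<rfloor>, \<lfloor>real (Suc n) * v R\<rfloor>, \<lfloor>real (Suc n) * w R\<rfloor>)" for n :: nat and R
  have hm: "h n \<in> measurable M (count_space UNIV)" for n
    unfolding h_def by measurable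
  show ?thesis
  proof (rule borel_measurable_LIMSEQ_real)
    show "(\<lambda>R. F n (h n R) R) \<in> borel_measurable M" for n
      by (rule measurable_compose_countable[OF Fm hm])
    fix R assume R: "R \<in> space M"
    have "F n (h n R) R = f R (s n \<lfloor>real (Suc n) * u R\<rfloor>) (s n \<lfloor>real (Suc n) * v R\<rfloor>) (s n \<lfloor>real (Suc n) * w R\<rfloor>)" for n
      using pos[OF R] by (simp add: F_def h_def less_imp_le)
    then show "(\<lambda>n. F n (h n R) R) \<longlonglongrightarrow> f R (u R) (v R) (w R)"
      using cont[OF R, of _ "u R" _ "v R" _ "w R"] pos[OF R] grid_tendsto by (simp add: s_def)
  qed
qed

text \<open>Young's inequality with exponents \<open>\<gamma>\<close> and
  \<open>\<gamma> / (\<gamma> - 1)\<close> for the product of g and 1 / (g w^2). The lower bound on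
  s lets the second power be compared with the singularity at zero volume.\<close>

lemma stretch_coercivity:
  fixes g w \<gamma> s :: real
  assumes g: "g > 0" and w: "w > 0" and \<gamma>: "1 < \<gamma>" and s: "s \<ge> \<gamma> / (\<gamma> - 1)"
  shows "1 / w\<^sup>2 \<le> g powr \<gamma> + (g * w\<^sup>2) powr (- s) + 1"
proof -
  define q where "q = \<gamma> / (\<gamma> - 1)"
  define d where "d = g * w\<^sup>2"
  have d: "d > 0" using g w by (simp add: d_def)
  have q: "q > 1" "1 / \<gamma> + 1 / q = 1" using \<gamma> by (auto simp: q_def field_simps)
  have "1 / w\<^sup>2 = g * (1 / d)" using g by (simp add: d_def)
  also have "\<dots> \<le> g powr \<gamma> / \<gamma> + (1 / d) powr q / q"
    by (rule Youngs_inequality) (use g d q \<gamma> in auto)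
  also have "\<dots> \<le> g powr \<gamma> + (1 / d) powr q"
    using \<gamma> q by (intro add_mono) (auto simp: divide_le_eq mult_le_cancel_left1)
  \<comment> \<open>For d <= 1 the exponent may be raised from q to s; for d > 1 the power is at
    most 1, the origin of the additive 1.\<close>
  also have "(1 / d) powr q \<le> d powr (- s) + 1"
  proof (cases "d \<le> 1")
    case True
    have "(1 / d) powr q \<le> (1 / d) powr s" using True d s by (intro powr_mono) (auto simp: q_def)
    also have "\<dots> = d powr (- s)" using d by (simp add: powr_minus powr_divide inverse_eq_divide)
    finally show ?thesis by simp
  next
    case False
    have "(1 / d) powr q \<le> 1" using False d q by (intro powr_le1) auto
    then show ?thesis by (simp add: add_increasing)
  qed
  finally show ?thesis by (simp add: d_def)
qed

section \<open>The star energy in terms of the slope\<close>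

text \<open>The measure does not see the half line below 0, so negative x are covered too; Helly's
  theorem asks for bounds on the whole line.\<close>

lemma tail_le_tail_0:
  assumes g: "integrable unit_leb g" "AE x in unit_leb. g x \<ge> 0"
  shows "tail g x \<le> tail g 0"
  unfolding tail_def
proof (rule integral_mono_AE)
  show "AE z in unit_leb. indicator {x..} z * g z \<le> indicator {0..} z * g z"
    using g(2) AE_unit_leb_in by eventually_elim (auto simp: indicator_def)
qed (use integrable_unit_leb_indicator[OF g(1)] in auto)

lemma tail_nonneg:
  assumes "AE x in unit_leb. g x \<ge> 0"
  shows "tail g x \<ge> 0"
  unfolding tail_def
  by (rule integral_nonneg_AE) (use assms in \<open>eventually_elim, auto simp: indicator_def\<close>)

lemma tail_cong_AE:
  assumes "integrable unit_leb g" "integrable unit_leb g'" "AE x in unit_leb. g x = g' x"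
  shows "tail g x = tail g' x"
  unfolding tail_def
  by (rule integral_cong_AE)
     (use assms integrable_unit_leb_indicator in \<open>auto intro!: borel_measurable_integrable\<close>)

lemma emeasure_unit_leb: "emeasure unit_leb (space unit_leb) = 1"
  by (subst emeasure_restrict_space) auto

text \<open>Serves to choose points tending to 0 at which an almost everywhere statement
  holds.\<close>

lemma AE_unit_leb_arbitrarily_small:
  assumes "AE x in unit_leb. P x" "d > 0"
  shows "\<exists>x. 0 < x \<and> x < d \<and> x < 1 \<and> P x"
proof (rule ccontr)
  assume "\<not> ?thesis"
  then have "AE x in unit_leb. x \<notin> {0<..<min d 1}" 
    using assms(1) by (auto elim: eventually_mono)
  moreover have "{0<..<min d 1} \<in> sets unit_leb" by (rule sets_unit_leb) auto
  ultimately have "{0<..<min d 1} \<in> null_sets unit_leb" by (simp add: AE_iff_null_sets)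
  then have "emeasure unit_leb {0<..<min d 1} = 0" by auto
  moreover have "emeasure unit_leb {0<..<min d 1} = ennreal (min d 1)"
    using assms(2) by (subst emeasure_restrict_space) (auto simp: min_def)
  ultimately show False using assms(2) by (auto simp: min_def split: if_splits)
qed

locale star_energy =
  fixes \<Phi> :: "real \<Rightarrow> real \<Rightarrow> real \<Rightarrow> real \<Rightarrow> real" and \<rho>0 :: "real \<Rightarrow> real" and l k1 C \<gamma> K s :: real
  assumes \<Phi>_nonneg: "\<And>R v1 v2 v3. \<lbrakk>0 \<le> R; R \<le> 1; v1 > 0; v2 > 0; v3 > 0\<rbrakk> \<Longrightarrow> \<Phi> R v1 v2 v3 \<ge> 0"
    and \<Phi>_symmetric: "symmetric_in_stretches \<Phi>"
    and \<Phi>_measurable: "\<And>v1 v2 v3. \<lbrakk>v1 > 0; v2 > 0; v3 > 0\<rbrakk> \<Longrightarrow>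
           (\<lambda>R. \<Phi> R v1 v2 v3) \<in> borel_measurable (lebesgue_on {0..1})"
    and \<Phi>_convex: "stretch_convex \<Phi>"
    and \<rho>0_measurable: "\<rho>0 \<in> borel_measurable (lebesgue_on {0..1})"
    and \<rho>0_bounds: "\<And>R. \<lbrakk>0 \<le> R; R \<le> 1\<rbrakk> \<Longrightarrow> 0 \<le> \<rho>0 R \<and> \<rho>0 R \<le> k1"
    and l_pos: "l > 0"
    and \<Phi>_lower: "\<And>R v1 v2 v3. \<lbrakk>0 \<le> R; R \<le> 1; v1 > 0; v2 > 0; v3 > 0\<rbrakk> \<Longrightarrow>
           \<Phi> R v1 v2 v3 \<ge> C * v1 powr \<gamma> + K * (v1 * v2 * v3) powr (- s)"
    and C_pos: "C > 0" and K_pos: "K > 0" and \<gamma>_gt: "1 < \<gamma>" and s_ge: "s \<ge> \<gamma> / (\<gamma> - 1)"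
begin

lemma k1_nonneg: "k1 \<ge> 0" using \<rho>0_bounds[of 0] by auto

text \<open>Symmetry carries convexity in the first stretch over to the other two, so separate
  convexity yields joint continuity.\<close>

lemma \<Phi>_tendsto:
  assumes R: "0 < R" "R < 1" and lim: "X \<longlonglongrightarrow> x" "Y \<longlonglongrightarrow> y" "Z \<longlonglongrightarrow> z" and pos: "x > 0" "y > 0" "z > 0"
  shows "(\<lambda>n::nat. \<Phi> R (X n) (Y n) (Z n)) \<longlonglongrightarrow> \<Phi> R x y z"
proof -
  have R': "R \<in> {0..1}" using R by auto
  have c1: "convex_on {0<..} (\<lambda>x. \<Phi> R x y z)" if "y > 0" "z > 0" for y z
    using \<Phi>_convex R' that by (simp add: stretch_convex_def)
  have s: "\<Phi> R x y z = \<Phi> R y x z" "\<Phi> R x y z = \<Phi> R x z y" if "x > 0" "y > 0" "z > 0" for x y z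
    using \<Phi>_symmetric R' that unfolding symmetric_in_stretches_def by blast+
  have c2: "convex_on {0<..} (\<lambda>y. \<Phi> R x y z)" if "x > 0" "z > 0" for x z
    using c1[OF that] by (rule convex_on_transfer) (use s that in auto)
  have c3: "convex_on {0<..} (\<lambda>z. \<Phi> R x y z)" if "x > 0" "y > 0" for x y
    using c2[OF that] by (rule convex_on_transfer) (use s that in auto)
  show ?thesis
    by (rule separately_convex_tendsto[where f="\<Phi> R", OF _ c1 c2 c3 lim pos]) (use \<Phi>_nonneg R in auto)
qed

lemma \<Phi>_comp_measurable:
  assumes "u \<in> borel_measurable unit_leb" "w \<in> borel_measurable unit_leb"
    and "\<And>R. 0 < R \<Longrightarrow> R < 1 \<Longrightarrow> u R > 0 \<and> w R > 0"
  shows "(\<lambda>R. \<Phi> R (u R) (w R) (w R)) \<in> borel_measurable unit_leb"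
proof (rule borel_measurable_Caratheodory[where f=\<Phi>])
  show "(\<lambda>R. \<Phi> R x y z) \<in> borel_measurable unit_leb" if "x > 0" "y > 0" "z > 0" for x y z
    using \<Phi>_measurable[OF that] by (rule measurable_restrict_mono) auto
qed (use assms \<Phi>_tendsto in auto)

section \<open>The enclosed mass\<close>

definition mass_density :: "real \<Rightarrow> real" where "mass_density u = \<rho>0 u * u\<^sup>2"

lemma \<rho>0_measurable_unit: "\<rho>0 \<in> borel_measurable unit_leb"
  using \<rho>0_measurable by (rule measurable_restrict_mono) auto

lemma mass_density_measurable: "mass_density \<in> borel_measurable (lebesgue_on {0..1})"
proof -
  have "(\<lambda>u::real. u\<^sup>2) \<in> borel_measurable (lebesgue_on {0..1})"
    by (intro continuous_imp_measurable_on_sets_lebesgue continuous_intros) auto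
  then show ?thesis unfolding mass_density_def[abs_def] using \<rho>0_measurable by measurable
qed

lemma mass_density_bounds: "0 \<le> u \<Longrightarrow> u \<le> 1 \<Longrightarrow> 0 \<le> mass_density u \<and> mass_density u \<le> k1"
  using \<rho>0_bounds[of u] mult_mono[of "\<rho>0 u" k1 "u\<^sup>2" 1] k1_nonneg by (auto simp: mass_density_def power_le_one)

lemma mass_density_integrable: "integrable unit_leb mass_density"
proof -
  interpret finite_measure unit_leb by (rule finite_unit_leb)
  show ?thesis
  proof (rule integrable_const_bound[where B=k1])
    show "mass_density \<in> borel_measurable unit_leb"
      using mass_density_measurable by (rule measurable_restrict_mono) auto
  qed (use mass_density_bounds in \<open>auto intro!: AE_I2\<close>)
qed

text \<open>Expressed through \<open>tail\<close>, the mass inherits continuity in R, hence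
  measurability, and its bounds.\<close>

lemma mass_within_eq:
  assumes R: "0 < R" "R < 1"
  shows "mass_within \<rho>0 R = 4 * pi * (tail mass_density 0 - tail mass_density R)"
proof -
  have "(LINT u|lebesgue_on {0..R}. \<rho>0 u * u\<^sup>2) = (LINT u|lebesgue. indicator {0..R} u *\<^sub>R mass_density u)"
    by (subst integral_restrict_space) (auto simp: mass_density_def)
  also have "\<dots> = (LINT u|lebesgue. indicator {0<..<1} u *\<^sub>R (indicator {0..} u * mass_density u - indicator {R..} u * mass_density u))"
  proof (rule integral_cong_AE)
    have "mass_density \<in> borel_measurable (lebesgue_on {0..R})"
      using mass_density_measurable by (rule measurable_restrict_mono) (use R in auto)
    then show "(\<lambda>u. indicator {0..R} u *\<^sub>R mass_density u) \<in> borel_measurable lebesgue"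
      by (subst (asm) borel_measurable_restrict_space_iff) auto
    have "(\<lambda>u. indicator {0..} u * mass_density u - indicator {R..} u * mass_density u) \<in> borel_measurable unit_leb"
      using integrable_unit_leb_indicator[OF mass_density_integrable] by auto
    then show "(\<lambda>u. indicator {0<..<1} u *\<^sub>R (indicator {0..} u * mass_density u - indicator {R..} u * mass_density u)) \<in> borel_measurable lebesgue"
      by (subst (asm) borel_measurable_restrict_space_iff) auto
    have "AE x in lebesgue. x \<notin> {0, R::real}" by (rule AE_not_in) simp
    then show "AE u in lebesgue. indicator {0..R} u *\<^sub>R mass_density u = 
        indicator {0<..<1} u *\<^sub>R (indicator {0..} u * mass_density u - indicator {R..} u * mass_density u)"
      by eventually_elim (use R in \<open>auto simp: indicator_def\<close>)
  qed
  also have "\<dots> = (LINT u|unit_leb. indicator {0..} u * mass_density u - indicator {R..} u * mass_density u)"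
    by (subst integral_restrict_space) auto
  also have "\<dots> = tail mass_density 0 - tail mass_density R"
    using integrable_unit_leb_indicator[OF mass_density_integrable] by (simp add: tail_def)
  finally show ?thesis by (simp add: mass_within_def)
qed

lemma mass_within_bounds:
  assumes R: "0 < R" "R < 1"
  shows "0 \<le> mass_within \<rho>0 R" "mass_within \<rho>0 R \<le> 4 * pi * k1"
proof -
  interpret finite_measure unit_leb by (rule finite_unit_leb)
  have nn: "AE x in unit_leb. mass_density x \<ge> 0" using mass_density_bounds by (intro AE_I2) auto
  have "tail mass_density R \<le> tail mass_density 0" by (rule tail_le_tail_0[OF mass_density_integrable nn])
  then show "0 \<le> mass_within \<rho>0 R" by (simp add: mass_within_eq[OF R])
  have "tail mass_density 0 \<le> (LINT u|unit_leb. k1)"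
    unfolding tail_def
    by (rule integral_mono[OF integrable_unit_leb_indicator[OF mass_density_integrable]])
       (use mass_density_bounds k1_nonneg in \<open>auto simp: indicator_def\<close>)
  also have "\<dots> = k1" using emeasure_unit_leb by (simp add: measure_def)
  finally have "tail mass_density 0 - tail mass_density R \<le> k1" using tail_nonneg[OF nn, of R] by simp
  then show "mass_within \<rho>0 R \<le> 4 * pi * k1" by (simp add: mass_within_eq[OF R])
qed

lemma mass_within_measurable: "mass_within \<rho>0 \<in> borel_measurable unit_leb"
proof -
  have "(\<lambda>R. 4 * pi * (tail mass_density 0 - tail mass_density R)) \<in> borel_measurable unit_leb"
    by (intro continuous_measurable_unit_leb continuous_intros continuous_on_subset[OF continuous_on_tail[OF mass_density_integrable]]) auto
  moreover have "mass_within \<rho>0 \<in> borel_measurable unit_leb \<longleftrightarrow> (\<lambda>R. 4 * pi * (tail mass_density 0 - tail mass_density R)) \<in> borel_measurable unit_leb"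
    by (rule measurable_cong) (simp add: mass_within_eq)
  ultimately show ?thesis by simp
qed

section \<open>The integrand and its coercivity\<close>

definition m0 :: real where "m0 = min C K"
definition \<kappa> :: real where "\<kappa> = 4 * pi * k1\<^sup>2"
text \<open>\<open>\<kappa>\<close> bounds density times enclosed mass. The term with its square
  comes from completing the square in R / w, the term m0 / 2 from the additive 1 in
  \<open>stretch_coercivity\<close>.\<close>

definition c0 :: real where "c0 = m0 / 2 + \<kappa>\<^sup>2 / (2 * m0)"

definition pot :: "real \<Rightarrow> real \<Rightarrow> real" where
  "pot R y = \<rho>0 R * (mass_within \<rho>0 R / y) * R\<^sup>2"

definition integrand :: "real \<Rightarrow> real \<Rightarrow> real \<Rightarrow> real" where
  "integrand R v w = \<Phi> R v w w * R\<^sup>2 - pot R (w * R) + c0"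

lemma m0_pos: "m0 > 0" using C_pos K_pos by (simp add: m0_def)
lemma c0_nonneg: "c0 \<ge> 0" using m0_pos by (simp add: c0_def)

lemma pot_nonneg: "0 < R \<Longrightarrow> R < 1 \<Longrightarrow> y > 0 \<Longrightarrow> pot R y \<ge> 0"
  using mass_within_bounds[of R] \<rho>0_bounds[of R] by (simp add: pot_def)

text \<open>The potential is at most linear in R / w, while coercivity controls the square of R / w.
  A weight m0 / 2 on that square costs only half of the stored energy.\<close>

lemma pot_le:
  assumes R: "0 < R" "R < 1" and v: "v > 0" and w: "w > 0"
  shows "pot R (w * R) \<le> \<Phi> R v w w * R\<^sup>2 / 2 + c0"
proof -
  have "\<rho>0 R * mass_within \<rho>0 R \<le> k1 * (4 * pi * k1)"
    using mass_within_bounds[OF R] \<rho>0_bounds[of R] R k1_nonneg by (intro mult_mono) auto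
  then have "pot R (w * R) \<le> \<kappa> / (w * R) * R\<^sup>2"
    unfolding pot_def \<kappa>_def times_divide_eq_right
    using R w by (intro mult_right_mono divide_right_mono) (auto simp: power2_eq_square mult_ac)
  also have "\<dots> = \<kappa> * (R / w)" using R w by (simp add: field_simps power2_eq_square)
  \<comment> \<open>The square of m0 (R / w) - \<open>\<kappa>\<close> is nonnegative.\<close>
  also have "\<dots> \<le> m0 * (R / w)\<^sup>2 / 2 + \<kappa>\<^sup>2 / (2 * m0)"
  proof -
    have "0 \<le> (m0 * (R / w) - \<kappa>)\<^sup>2 / (2 * m0)" using m0_pos by simp
    also have "\<dots> = m0 * (R / w)\<^sup>2 / 2 + \<kappa>\<^sup>2 / (2 * m0) - \<kappa> * (R / w)"
    proof -
      have "(m0 * q - \<kappa>)\<^sup>2 / (2 * m0) = m0 * q\<^sup>2 / 2 + \<kappa>\<^sup>2 / (2 * m0) - \<kappa> * q" for q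
        using m0_pos by (simp add: field_simps power2_eq_square)
      then show ?thesis .
    qed
    finally show ?thesis by simp
  qed
  also have "m0 * (R / w)\<^sup>2 / 2 \<le> \<Phi> R v w w * R\<^sup>2 / 2 + m0 / 2"
  proof -
    have "1 / w\<^sup>2 \<le> v powr \<gamma> + (v * w\<^sup>2) powr (- s) + 1"
      by (rule stretch_coercivity[OF v w \<gamma>_gt s_ge])
    then have "m0 * (1 / w\<^sup>2) \<le> m0 * (v powr \<gamma> + (v * w\<^sup>2) powr (- s) + 1)"
      using m0_pos by (intro mult_left_mono) auto
    also have "\<dots> \<le> C * v powr \<gamma> + K * (v * w * w) powr (- s) + m0"
      unfolding distrib_left using m0_pos
      by (intro add_mono mult_mono) (auto simp: m0_def power2_eq_square mult_ac)
    also have "\<dots> \<le> \<Phi> R v w w + m0" using \<Phi>_lower[of R v w w] R v w by simp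
    finally have "m0 * (1 / w\<^sup>2) * R\<^sup>2 \<le> (\<Phi> R v w w + m0) * R\<^sup>2" by (intro mult_right_mono) auto
    also have "\<dots> \<le> \<Phi> R v w w * R\<^sup>2 + m0"
      using R m0_pos by (simp add: distrib_right mult_le_cancel_left1 power_le_one)
    finally show ?thesis by (simp add: power_divide)
  qed
  finally show ?thesis by (simp add: c0_def)
qed

lemma integrand_lower:
  assumes "0 < R" "R < 1" "v > 0" "w > 0"
  shows "\<Phi> R v w w * R\<^sup>2 \<le> 2 * integrand R v w" "0 \<le> integrand R v w"
proof -
  show 1: "\<Phi> R v w w * R\<^sup>2 \<le> 2 * integrand R v w" using pot_le[OF assms] unfolding integrand_def by argo
  have "0 \<le> \<Phi> R v w w * R\<^sup>2" using \<Phi>_nonneg[of R v w w] assms by simp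
  then show "0 \<le> integrand R v w" using 1 by simp
qed

text \<open>For fixed w the gravitational term is constant in the slope, so its negative sign does
  not disturb convexity.\<close>

lemma integrand_convex:
  assumes "0 < R" "R < 1" "w > 0"
  shows "convex_on {0<..} (\<lambda>v. integrand R v w)"
proof -
  have "convex_on {0<..} (\<lambda>v. \<Phi> R v w w)" using \<Phi>_convex assms by (simp add: stretch_convex_def)
  then have "convex_on {0<..} (\<lambda>v. R\<^sup>2 * \<Phi> R v w w)" by (rule convex_on_cmul[rotated]) simp
  then have "convex_on {0<..} (\<lambda>v. R\<^sup>2 * \<Phi> R v w w + (c0 - pot R (w * R)))"
    by (rule convex_on_add) (simp add: convex_on_const)
  then show ?thesis by (simp add: integrand_def algebra_simps)
qed

lemma integrand_tendsto:
  assumes R: "0 < R" "R < 1" and W: "W \<longlonglongrightarrow> w" and pos: "w > 0" "v > 0"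
  shows "(\<lambda>n::nat. integrand R v (W n)) \<longlonglongrightarrow> integrand R v w"
  unfolding integrand_def pot_def
  by (intro tendsto_intros \<Phi>_tendsto R W) (use R pos in auto)

text \<open>An admissible deformation is encoded by an everywhere positive representative \<open>g\<close> of its weak
  derivative; the boundary condition at 1 then gives \<open>r = rad g\<close>, and \<open>r 0 \<ge> 0\<close> reads
  \<open>tail g 0 \<le> l\<close>.\<close>

definition rad :: "(real \<Rightarrow> real) \<Rightarrow> real \<Rightarrow> real" where "rad g x = l - tail g x"

definition slopes :: "(real \<Rightarrow> real) set" where
  "slopes = {g. integrable unit_leb g \<and> (\<forall>x. g x > 0) \<and> tail g 0 \<le> l}"

text \<open>The total energy plus \<open>c0\<close>, the interval having length 1. As the integral
  of a nonnegative function on \<open>slopes\<close> it involves no difference of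
  infinities.\<close>

definition shifted_energy :: "(real \<Rightarrow> real) \<Rightarrow> ennreal" where
  "shifted_energy g = (\<integral>\<^sup>+R. ennreal (integrand R (g R) (rad g R / R)) \<partial>unit_leb)"

lemma rad_pos:
  assumes "g \<in> slopes" "0 < x" "x \<le> 1"
  shows "rad g x > 0"
  unfolding rad_def by (rule minus_tail_pos) (use assms in \<open>auto simp: slopes_def\<close>)

lemma rad_le: "g \<in> slopes \<Longrightarrow> rad g x \<le> l"
  unfolding rad_def slopes_def using tail_nonneg[of g x] by (auto simp: less_imp_le)

lemma slopes_measurable:
  assumes "g \<in> slopes"
  shows "g \<in> borel_measurable unit_leb" "(\<lambda>R. rad g R / R) \<in> borel_measurable unit_leb"
proof -
  show "g \<in> borel_measurable unit_leb" using assms by (auto simp: slopes_def)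
  show "(\<lambda>R. rad g R / R) \<in> borel_measurable unit_leb"
    unfolding rad_def
    by (intro continuous_measurable_unit_leb continuous_intros continuous_on_subset[OF continuous_on_tail]) 
       (use assms in \<open>auto simp: slopes_def\<close>)
qed

lemma energy_measurable:
  assumes g: "g \<in> slopes"
  shows "(\<lambda>R. \<Phi> R (g R) (rad g R / R) (rad g R / R) * R\<^sup>2) \<in> borel_measurable unit_leb"
    and "(\<lambda>R. pot R (rad g R)) \<in> borel_measurable unit_leb"
    and "(\<lambda>R. integrand R (g R) (rad g R / R)) \<in> borel_measurable unit_leb"
proof -
  have [measurable]: "(\<lambda>R. R) \<in> borel_measurable unit_leb" by (rule borel_measurable_unit_leb) auto
  have [measurable]: "(\<lambda>R. \<Phi> R (g R) (rad g R / R) (rad g R / R)) \<in> borel_measurable unit_leb"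
    by (rule \<Phi>_comp_measurable[OF slopes_measurable[OF g]]) (use g rad_pos in \<open>auto simp: slopes_def\<close>)
  show 1: "(\<lambda>R. \<Phi> R (g R) (rad g R / R) (rad g R / R) * R\<^sup>2) \<in> borel_measurable unit_leb" by measurable
  have [measurable]: "rad g \<in> borel_measurable unit_leb" 
    unfolding rad_def[abs_def]
    by (intro continuous_measurable_unit_leb continuous_intros continuous_on_subset[OF continuous_on_tail]) 
       (use g in \<open>auto simp: slopes_def\<close>)
  note [measurable] = \<rho>0_measurable_unit mass_within_measurable
  show 2 [measurable]: "(\<lambda>R. pot R (rad g R)) \<in> borel_measurable unit_leb" unfolding pot_def by measurable
  have "(\<lambda>R. integrand R (g R) (rad g R / R)) \<in> borel_measurable unit_leb \<longleftrightarrow> 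
     (\<lambda>R. \<Phi> R (g R) (rad g R / R) (rad g R / R) * R\<^sup>2 - pot R (rad g R) + c0) \<in> borel_measurable unit_leb"
    by (rule measurable_cong) (auto simp: integrand_def)
  moreover have "(\<lambda>R. \<Phi> R (g R) (rad g R / R) (rad g R / R) * R\<^sup>2 - pot R (rad g R) + c0) \<in> borel_measurable unit_leb"
    by measurable
  ultimately show "(\<lambda>R. integrand R (g R) (rad g R / R)) \<in> borel_measurable unit_leb" by simp
qed

definition mech_energy :: "(real \<Rightarrow> real) \<Rightarrow> ennreal" where
  "mech_energy g = (\<integral>\<^sup>+R. ennreal (\<Phi> R (g R) (rad g R / R) (rad g R / R) * R\<^sup>2) \<partial>unit_leb)"

text \<open>The identity is additive because subtraction of \<open>ennreal\<close> truncates; once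
  the terms are known to be finite, it becomes one between reals.\<close>

lemma mech_energy_shifted:
  assumes g: "g \<in> slopes"
  shows "mech_energy g + ennreal c0 = shifted_energy g + I_pot \<rho>0 (rad g)" and "mech_energy g \<le> 2 * shifted_energy g"
proof -
  have gp: "g R > 0" "rad g R / R > 0" "rad g R > 0" if "0 < R" "R < 1" for R
    using g rad_pos[OF g, of R] that by (auto simp: slopes_def)
  have "mech_energy g + ennreal c0 = (\<integral>\<^sup>+R. ennreal (\<Phi> R (g R) (rad g R / R) (rad g R / R) * R\<^sup>2) + ennreal c0 \<partial>unit_leb)"
    unfolding mech_energy_def using energy_measurable(1)[OF g] emeasure_unit_leb
    by (subst nn_integral_add) auto
  also have "\<dots> = (\<integral>\<^sup>+R. ennreal (integrand R (g R) (rad g R / R)) + ennreal (pot R (rad g R)) \<partial>unit_leb)"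
  proof (rule nn_integral_cong)
    fix R assume "R \<in> space unit_leb"
    then have R: "0 < R" "R < 1" by auto
    have e: "\<Phi> R (g R) (rad g R / R) (rad g R / R) * R\<^sup>2 + c0 = integrand R (g R) (rad g R / R) + pot R (rad g R)"
      using R by (simp add: integrand_def)
    have nn: "0 \<le> \<Phi> R (g R) (rad g R / R) (rad g R / R) * R\<^sup>2"
      using \<Phi>_nonneg[of R "g R" "rad g R / R" "rad g R / R"] gp[OF R] R by simp
    then show "ennreal (\<Phi> R (g R) (rad g R / R) (rad g R / R) * R\<^sup>2) + ennreal c0 = 
        ennreal (integrand R (g R) (rad g R / R)) + ennreal (pot R (rad g R))"
      using e c0_nonneg integrand_lower(2)[OF R gp(1,2)[OF R]] pot_nonneg[OF R gp(3)[OF R]]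
      by (simp add: ennreal_plus[symmetric] del: ennreal_plus)
  qed
  also have "\<dots> = shifted_energy g + I_pot \<rho>0 (rad g)"
    unfolding shifted_energy_def I_pot_def pot_def[symmetric] using energy_measurable(2,3)[OF g]
    by (subst nn_integral_add) auto
  finally show "mech_energy g + ennreal c0 = shifted_energy g + I_pot \<rho>0 (rad g)" .
  have "mech_energy g \<le> (\<integral>\<^sup>+R. 2 * ennreal (integrand R (g R) (rad g R / R)) \<partial>unit_leb)"
    unfolding mech_energy_def
  proof (rule nn_integral_mono)
    fix R assume "R \<in> space unit_leb"
    then have R: "0 < R" "R < 1" by auto
    have "ennreal (\<Phi> R (g R) (rad g R / R) (rad g R / R) * R\<^sup>2) \<le> ennreal (2 * integrand R (g R) (rad g R / R))"
      using integrand_lower(1)[OF R gp(1,2)[OF R]] by (rule ennreal_leI)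
    then show "ennreal (\<Phi> R (g R) (rad g R / R) (rad g R / R) * R\<^sup>2) \<le> 2 * ennreal (integrand R (g R) (rad g R / R))"
      by (simp add: ennreal_mult')
  qed
  also have "\<dots> = 2 * shifted_energy g" unfolding shifted_energy_def using energy_measurable(3)[OF g] by (subst nn_integral_cmult) auto
  finally show "mech_energy g \<le> 2 * shifted_energy g" .
qed

text \<open>Together with \<open>slope_admissible\<close> this reduces the problem to minimizing the
  real values of \<open>shifted_energy\<close> over \<open>slopes\<close>. Finite mechanical energy
  forces a finite potential, by the additive identity.\<close>

lemma admissible_slope:
  assumes "r \<in> admissible \<Phi> l"
  obtains g j where "g \<in> slopes" "j \<ge> 0" "shifted_energy g = ennreal j" "I_total \<Phi> \<rho>0 r = ereal (j - c0)"
proof (rule admissibleE[OF assms])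
  fix g assume g: "integrable unit_leb g" "\<And>x. g x > 0" "\<And>x. x \<in> {0..1} \<Longrightarrow> r x = l - tail g x" "r 0 \<ge> 0"
    and "has_weak_derivative r g" "continuous_on {0..1} r"
    and mg: "I_mec \<Phi> r = (\<integral>\<^sup>+R. ennreal (\<Phi> R (g R) (r R / R) (r R / R) * R\<^sup>2) \<partial>unit_leb)"
  have gs: "g \<in> slopes" using g by (auto simp: slopes_def)
  have rr: "r x = rad g x" if "x \<in> {0..1}" for x using g(3)[OF that] by (simp add: rad_def)
  have mec: "I_mec \<Phi> r = mech_energy g" unfolding mg mech_energy_def by (rule nn_integral_cong) (simp add: rr)
  have pot: "I_pot \<rho>0 r = I_pot \<rho>0 (rad g)" unfolding I_pot_def by (rule nn_integral_cong) (simp add: rr)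
  have fin: "mech_energy g < \<top>" using assms mec by (simp add: admissible_def)
  then have "shifted_energy g + I_pot \<rho>0 (rad g) < \<top>" unfolding mech_energy_shifted(1)[OF gs, symmetric] by simp
  then have "shifted_energy g < \<top>" "I_pot \<rho>0 (rad g) < \<top>" by auto
  with fin obtain i j p where i: "0 \<le> i" "mech_energy g = ennreal i" and j: "0 \<le> j" "shifted_energy g = ennreal j" 
      and p: "0 \<le> p" "I_pot \<rho>0 (rad g) = ennreal p"
    unfolding less_top_ennreal by blast
  have "ennreal (i + c0) = ennreal (j + p)"
    using mech_energy_shifted(1)[OF gs] i j p c0_nonneg by (simp add: ennreal_plus[symmetric] del: ennreal_plus)
  then have e: "i + c0 = j + p" using i j p c0_nonneg by (subst (asm) ennreal_inj) auto
  have "I_total \<Phi> \<rho>0 r = ereal i - ereal p"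
    unfolding I_total_def mec pot i p using i p by (simp add: enn2ereal_ennreal)
  also have "\<dots> = ereal (j - c0)" using e by simp
  finally show ?thesis using that[OF gs j] by simp
qed

lemma slope_admissible:
  assumes g: "g \<in> slopes" and fin: "shifted_energy g = ennreal j" "j \<ge> 0"
  shows "rad g \<in> admissible \<Phi> l" "I_total \<Phi> \<rho>0 (rad g) = ereal (j - c0)"
proof -
  have "mech_energy g \<le> 2 * shifted_energy g" by (rule mech_energy_shifted(2)[OF g])
  also have "\<dots> < \<top>" using fin by (simp add: ennreal_mult_less_top)
  finally have mf: "mech_energy g < \<top>" .
  show ad: "rad g \<in> admissible \<Phi> l"
    by (rule admissibleI[of g]) (use g mf in \<open>auto simp: slopes_def rad_def mech_energy_def\<close>)
  have cont: "continuous_on {0..1} (rad g)" using ad by (simp add: admissible_def)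
  have w: "has_weak_derivative (rad g) g"
    by (rule has_weak_derivative_tail[where c=l]) (use g in \<open>auto simp: rad_def slopes_def\<close>)
  have mec: "I_mec \<Phi> (rad g) = mech_energy g" unfolding mech_energy_def by (rule I_mec_eq[OF cont w])
  have "shifted_energy g + I_pot \<rho>0 (rad g) < \<top>" unfolding mech_energy_shifted(1)[OF g, symmetric] using mf by simp
  then have "I_pot \<rho>0 (rad g) < \<top>" by auto
  with mf obtain i p where i: "0 \<le> i" "mech_energy g = ennreal i" 
      and p: "0 \<le> p" "I_pot \<rho>0 (rad g) = ennreal p"
    unfolding less_top_ennreal by blast
  have "ennreal (i + c0) = ennreal (j + p)"
    using mech_energy_shifted(1)[OF g] i fin p c0_nonneg by (simp add: ennreal_plus[symmetric] del: ennreal_plus)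
  then have e: "i + c0 = j + p" using i fin p c0_nonneg by (subst (asm) ennreal_inj) auto
  have "I_total \<Phi> \<rho>0 (rad g) = ereal i - ereal p"
    unfolding I_total_def mec i p using i p by (simp add: enn2ereal_ennreal)
  also have "\<dots> = ereal (j - c0)" using e by simp
  finally show "I_total \<Phi> \<rho>0 (rad g) = ereal (j - c0)" .
qed

subsection \<open>Compactness and lower semicontinuity\<close>

text \<open>Each \<open>rad (g j)\<close> is continuous, increasing and bounded by l in modulus on
  the whole line, as Helly's theorem requires. The limit is attained at its continuity points, and a
  monotone function has countably many others.\<close>

lemma tail_subsequence:
  assumes g: "\<And>j. g j \<in> slopes"
  obtains \<sigma> T where "strict_mono (\<sigma> :: nat \<Rightarrow> nat)" "AE x in unit_leb. (\<lambda>j. tail (g (\<sigma> j)) x) \<longlonglongrightarrow> T x"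
proof -
  have gi: "integrable unit_leb (g j)" and g0: "AE x in unit_leb. g j x \<ge> 0" and gl: "tail (g j) 0 \<le> l" for j
    using g[of j] by (auto simp: slopes_def less_imp_le)
  have "\<exists>\<sigma>. strict_mono (\<sigma> :: nat \<Rightarrow> nat) \<and> (\<exists>H. (\<forall>x. continuous (at_right x) H) \<and> mono H \<and> (\<forall>x. \<bar>H x\<bar> \<le> l) \<and>
    (\<forall>x. continuous (at x) H \<longrightarrow> (\<lambda>n. rad (g (\<sigma> n)) x) \<longlonglongrightarrow> H x))"
  proof (rule Helly_selection[where f="\<lambda>j. rad (g j)"])
    show "continuous (at_right x) (rad (g n))" for n x
    proof -
      have "continuous_on UNIV (rad (g n))"
        unfolding rad_def[abs_def] by (intro continuous_intros continuous_on_tail gi)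
      then have "isCont (rad (g n)) x" by (simp add: continuous_on_eq_continuous_at)
      then show ?thesis by (rule continuous_at_imp_continuous_at_within)
    qed
    show "mono (rad (g n))" for n
      unfolding mono_def rad_def using tail_mono[OF gi g0] by simp
    show "\<bar>rad (g n) x\<bar> \<le> l" for n x
      using tail_le_tail_0[OF gi g0, of n x] tail_nonneg[OF g0, of n x] gl[of n] by (simp add: rad_def)
  qed
  then obtain \<sigma> H where \<sigma>: "strict_mono (\<sigma> :: nat \<Rightarrow> nat)" and H: "mono H" 
    "\<And>x. isCont H x \<Longrightarrow> (\<lambda>n. rad (g (\<sigma> n)) x) \<longlonglongrightarrow> H x" by blast
  have "countable {x. \<not> isCont H x}" by (rule mono_ctble_discont[OF H(1)])
  then have "{x. \<not> isCont H x} \<in> null_sets lebesgue"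
    using countable_imp_null_set_lborel by (auto intro: null_sets_completionI)
  then have "AE x in lebesgue. isCont H x" by (rule AE_I') auto
  then have "AE x in unit_leb. isCont H x" by (subst AE_restrict_space_iff) auto
  then have "AE x in unit_leb. (\<lambda>j. tail (g (\<sigma> j)) x) \<longlonglongrightarrow> l - H x"
  proof eventually_elim
    case (elim x)
    have "(\<lambda>n. l - rad (g (\<sigma> n)) x) \<longlonglongrightarrow> l - H x" by (intro tendsto_intros H(2) elim)
    then show ?case by (simp add: rad_def)
  qed
  from that[OF \<sigma> this] show thesis .
qed

lemma entropy_bound:
  assumes g: "g \<in> slopes" and j: "shifted_energy g = ennreal j" "j \<ge> 0"
  shows "integrable (density unit_leb (\<lambda>R. ennreal (R\<^sup>2))) (\<lambda>R. ent (g R))"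
    and "(LINT R|density unit_leb (\<lambda>R. ennreal (R\<^sup>2)). ent (g R)) \<le> 2 / (C * (\<gamma> - 1)) * j + 1"
proof -
  \<comment> \<open>The 2 is from \<open>integrand_lower\<close>, 1 / C from the growth in the first
    stretch, 1 / (\<open>\<gamma>\<close> - 1) from \<open>ent_le_powr\<close>.\<close>
  define k where "k = 2 / (C * (\<gamma> - 1))"
  have k: "k \<ge> 0" using C_pos \<gamma>_gt by (simp add: k_def)
  have [measurable]: "(\<lambda>R. R) \<in> borel_measurable unit_leb" by (rule borel_measurable_unit_leb) auto
  note [measurable] = slopes_measurable(1)[OF g] energy_measurable(3)[OF g]
  have gp: "g R > 0" for R using g by (simp add: slopes_def)
  have eg: "ent (g R) \<ge> 0" for R using ent_ge[OF gp[of R]] gp[of R] by simp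
  have pw: "R\<^sup>2 * ent (g R) \<le> k * integrand R (g R) (rad g R / R) + 1" if R: "0 < R" "R < 1" for R
  proof -
    have w: "rad g R / R > 0" using rad_pos[OF g, of R] R by simp
    have "C * g R powr \<gamma> \<le> C * g R powr \<gamma> + K * (g R * (rad g R / R) * (rad g R / R)) powr (- s)"
      using K_pos by simp
    also have "\<dots> \<le> \<Phi> R (g R) (rad g R / R) (rad g R / R)" using R by (intro \<Phi>_lower gp w) auto
    finally have "C * g R powr \<gamma> * R\<^sup>2 \<le> \<Phi> R (g R) (rad g R / R) (rad g R / R) * R\<^sup>2" by (rule mult_right_mono) simp
    also have "\<dots> \<le> 2 * integrand R (g R) (rad g R / R)" by (rule integrand_lower(1)[OF R gp w])
    finally have 1: "C * g R powr \<gamma> * R\<^sup>2 \<le> 2 * integrand R (g R) (rad g R / R)" .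
    have "R\<^sup>2 * ent (g R) \<le> R\<^sup>2 * (g R powr \<gamma> / (\<gamma> - 1) + 1)"
      using ent_le_powr[OF gp \<gamma>_gt] by (intro mult_left_mono) auto
    also have "\<dots> = 1 / (C * (\<gamma> - 1)) * (C * g R powr \<gamma> * R\<^sup>2) + R\<^sup>2"
      using C_pos \<gamma>_gt by (simp add: field_simps)
    also have "\<dots> \<le> 1 / (C * (\<gamma> - 1)) * (2 * integrand R (g R) (rad g R / R)) + 1"
      using C_pos \<gamma>_gt R 1 by (intro add_mono mult_left_mono) (auto simp: power_le_one)
    finally show ?thesis by (simp add: k_def)
  qed
  have "(\<integral>\<^sup>+R. ennreal (R\<^sup>2 * ent (g R)) \<partial>unit_leb) \<le> (\<integral>\<^sup>+R. ennreal k * ennreal (integrand R (g R) (rad g R / R)) + 1 \<partial>unit_leb)"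
  proof (rule nn_integral_mono)
    fix R assume "R \<in> space unit_leb"
    then have R: "0 < R" "R < 1" by auto
    have "rad g R / R > 0" using rad_pos[OF g, of R] R by simp
    then have "0 \<le> integrand R (g R) (rad g R / R)" by (intro integrand_lower(2)[OF R gp])
    then have "ennreal k * ennreal (integrand R (g R) (rad g R / R)) + 1 = ennreal (k * integrand R (g R) (rad g R / R) + 1)"
      using k by (simp add: ennreal_mult)
    then show "ennreal (R\<^sup>2 * ent (g R)) \<le> ennreal k * ennreal (integrand R (g R) (rad g R / R)) + 1"
      using ennreal_leI[OF pw[OF R]] by simp
  qed
  also have "\<dots> = ennreal k * shifted_energy g + 1"
    unfolding shifted_energy_def using emeasure_unit_leb by (simp add: nn_integral_add nn_integral_cmult)
  also have "\<dots> = ennreal (k * j + 1)" using k j by (simp add: ennreal_mult)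
  finally have le: "(\<integral>\<^sup>+R. ennreal (R\<^sup>2 * ent (g R)) \<partial>unit_leb) \<le> ennreal (k * j + 1)" .
  have i: "integrable unit_leb (\<lambda>R. R\<^sup>2 * ent (g R))"
  proof (rule integrableI_nonneg)
    show "(\<integral>\<^sup>+R. ennreal (R\<^sup>2 * ent (g R)) \<partial>unit_leb) < \<infinity>" using le by (rule order_le_less_trans) simp
  qed (use eg in auto)
  have "ennreal (LINT R|unit_leb. R\<^sup>2 * ent (g R)) \<le> ennreal (k * j + 1)"
    using nn_integral_eq_integral[OF i] eg le by simp
  then have il: "(LINT R|unit_leb. R\<^sup>2 * ent (g R)) \<le> k * j + 1" using k j by (subst (asm) ennreal_le_iff) auto
  show "integrable (density unit_leb (\<lambda>R. ennreal (R\<^sup>2))) (\<lambda>R. ent (g R))"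
    using i by (subst integrable_density) auto
  show "(LINT R|density unit_leb (\<lambda>R. ennreal (R\<^sup>2)). ent (g R)) \<le> 2 / (C * (\<gamma> - 1)) * j + 1"
    using il by (subst integral_density) (auto simp: k_def)
qed

text \<open>As w <= l / R, the volume ratio v w^2 is at most v l^2 / R^2, so a small slope forces a
  small volume. Conjugacy gives s >= 1, hence a singularity at least as strong as 1 / v.\<close>

lemma integrand_blow_up_bound:
  assumes R: "0 < R" "R < 1" and v: "v > 0" and w: "w > 0" "w \<le> l / R"
  shows "integrand R v w \<ge> R\<^sup>2 * K / 2 * (R\<^sup>2 / l\<^sup>2) / v - R\<^sup>2 * K / 2"
proof -
  define d where "d = v * w * w"
  have d: "d > 0" using v w by (simp add: d_def)
  have "\<gamma> / (\<gamma> - 1) \<ge> 1" using \<gamma>_gt by (simp add: field_simps)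
  then have s1: "s \<ge> 1" using s_ge by simp
  have "w * w \<le> (l / R) * (l / R)" using w by (intro mult_mono) auto
  then have "v * (w * w) \<le> v * ((l / R) * (l / R))" using v by (intro mult_left_mono) auto
  then have "1 / (v * ((l / R) * (l / R))) \<le> 1 / d"
    using d l_pos R v by (intro divide_left_mono) (auto simp: d_def mult.assoc)
  then have 1: "R\<^sup>2 / l\<^sup>2 / v \<le> 1 / d" by (simp add: power2_eq_square mult_ac)
  have 2: "1 / d \<le> d powr (- s) + 1"
  proof (cases "d \<le> 1")
    case True
    have "1 / d = d powr (- 1)" using d by (simp add: powr_minus inverse_eq_divide)
    also have "\<dots> \<le> d powr (- s)" using d True s1 by (intro powr_mono') auto
    finally show ?thesis by simp
  next
    case False
    then have "1 / d \<le> 1" by simp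
    then show ?thesis by (simp add: add_increasing)
  qed
  have "K * d powr (- s) \<le> C * v powr \<gamma> + K * d powr (- s)" using C_pos by simp
  also have "\<dots> \<le> \<Phi> R v w w" using \<Phi>_lower[of R v w w] R v w by (simp add: d_def)
  finally have "K * d powr (- s) * R\<^sup>2 \<le> \<Phi> R v w w * R\<^sup>2" by (rule mult_right_mono) simp
  also have "\<dots> \<le> 2 * integrand R v w" by (rule integrand_lower(1)[OF R v w(1)])
  finally have 3: "R\<^sup>2 * K / 2 * (d powr (- s)) \<le> integrand R v w" by (simp add: mult_ac)
  have "R\<^sup>2 * K / 2 * (R\<^sup>2 / l\<^sup>2 / v) \<le> R\<^sup>2 * K / 2 * (d powr (- s) + 1)"
    using 1 2 K_pos by (intro mult_left_mono) auto
  then show ?thesis using 3 by (simp add: distrib_left)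
qed

text \<open>On [x, 1] the weight is at least x^2, so weighted L^1 convergence is ordinary L^1
  convergence there. Nothing is claimed at the center.\<close>

lemma tail_weighted_limit:
  assumes h: "\<And>n. integrable unit_leb (h n)" and G: "integrable unit_leb (\<lambda>R. R\<^sup>2 * G R)"
    and Gm: "G \<in> borel_measurable unit_leb"
    and lim: "(\<lambda>n. LINT R|unit_leb. R\<^sup>2 * \<bar>h n R - G R\<bar>) \<longlonglongrightarrow> 0" and x: "0 < x"
  shows "integrable unit_leb (\<lambda>y. indicator {x..} y * G y)" and "(\<lambda>n. tail (h n) x) \<longlonglongrightarrow> tail G x"
proof -
  have [measurable]: "(\<lambda>R. R) \<in> borel_measurable unit_leb" "(\<lambda>R. indicator {x..} R :: real) \<in> borel_measurable unit_leb" 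
    by (rule borel_measurable_unit_leb, simp)+
  have [measurable]: "h n \<in> borel_measurable unit_leb" for n using h[of n] by auto
  note [measurable] = Gm
  have ind: "indicator {x..} y \<le> (1 / x\<^sup>2) * y\<^sup>2" for y :: real
    using x by (auto simp: indicator_def field_simps intro!: power_mono)
  show iG: "integrable unit_leb (\<lambda>y. indicator {x..} y * G y)"
  proof (rule Bochner_Integration.integrable_bound)
    show "integrable unit_leb (\<lambda>R. (1 / x\<^sup>2) * (R\<^sup>2 * G R))" using G by (intro integrable_mult_right)
    show "AE y in unit_leb. norm (indicator {x..} y * G y) \<le> norm ((1 / x\<^sup>2) * (y\<^sup>2 * G y))"
    proof (rule AE_I2)
      fix y
      have "indicator {x..} y * \<bar>G y\<bar> \<le> (1 / x\<^sup>2) * y\<^sup>2 * \<bar>G y\<bar>" by (rule mult_right_mono[OF ind]) simp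
      then show "norm (indicator {x..} y * G y) \<le> norm ((1 / x\<^sup>2) * (y\<^sup>2 * G y))"
        by (simp add: abs_mult)
    qed
  qed measurable
  have y2h: "integrable unit_leb (\<lambda>y. y\<^sup>2 * h n y)" for n
  proof (rule Bochner_Integration.integrable_bound[OF h])
    show "AE y in unit_leb. norm (y\<^sup>2 * h n y) \<le> norm (h n y)"
      by (rule AE_I2) (auto simp: abs_mult power_le_one intro!: mult_left_le_one_le)
  qed measurable
  have ih: "integrable unit_leb (\<lambda>y. y\<^sup>2 * \<bar>h n y - G y\<bar>)" for n
  proof -
    have "integrable unit_leb (\<lambda>y. \<bar>y\<^sup>2 * h n y - y\<^sup>2 * G y\<bar>)" using y2h G by auto
    moreover have "\<bar>y\<^sup>2 * h n y - y\<^sup>2 * G y\<bar> = y\<^sup>2 * \<bar>h n y - G y\<bar>" for y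
      by (simp add: right_diff_distrib[symmetric] abs_mult)
    ultimately show ?thesis by simp
  qed
  have bound: "norm (tail (h n) x - tail G x) \<le> (1 / x\<^sup>2) * (LINT R|unit_leb. R\<^sup>2 * \<bar>h n R - G R\<bar>)" for n
  proof -
    have i: "integrable unit_leb (\<lambda>y. indicator {x..} y * h n y)"
      by (rule integrable_unit_leb_indicator[OF h]) simp
    have "tail (h n) x - tail G x = (LINT y|unit_leb. indicator {x..} y * h n y - indicator {x..} y * G y)"
      unfolding tail_def using i iG by simp
    also have "norm \<dots> \<le> (LINT y|unit_leb. norm (indicator {x..} y * h n y - indicator {x..} y * G y))"
      by (rule integral_norm_bound)
    also have "\<dots> \<le> (LINT y|unit_leb. (1 / x\<^sup>2) * (y\<^sup>2 * \<bar>h n y - G y\<bar>))"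
    proof (rule integral_mono)
      show "integrable unit_leb (\<lambda>y. (1 / x\<^sup>2) * (y\<^sup>2 * \<bar>h n y - G y\<bar>))" by (intro integrable_mult_right ih)
      fix y
      have "indicator {x..} y * \<bar>h n y - G y\<bar> \<le> (1 / x\<^sup>2) * y\<^sup>2 * \<bar>h n y - G y\<bar>"
        by (rule mult_right_mono[OF ind]) simp
      then show "norm (indicator {x..} y * h n y - indicator {x..} y * G y) \<le> (1 / x\<^sup>2) * (y\<^sup>2 * \<bar>h n y - G y\<bar>)"
        by (simp add: right_diff_distrib[symmetric] abs_mult)
    qed (use i iG in auto)
    also have "\<dots> = (1 / x\<^sup>2) * (LINT R|unit_leb. R\<^sup>2 * \<bar>h n R - G R\<bar>)" by (rule integral_mult_right_zero)
    finally show ?thesis .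
  qed
  have "(\<lambda>n. (1 / x\<^sup>2) * (LINT R|unit_leb. R\<^sup>2 * \<bar>h n R - G R\<bar>)) \<longlonglongrightarrow> 0"
    by (rule tendsto_mult_right_zero[OF lim])
  with bound have "(\<lambda>n. tail (h n) x - tail G x) \<longlonglongrightarrow> 0"
    by (rule Lim_null_comparison[OF always_eventually, OF allI])
  then show "(\<lambda>n. tail (h n) x) \<longlonglongrightarrow> tail G x" by (simp add: Lim_null[symmetric])
qed

text \<open>Lower semicontinuity of the energy and closedness of the constraints at once, along any
  sequence in \<open>slopes\<close> whose energies and primitives converge.\<close>

lemma energy_limit:
  assumes g: "\<And>i. g i \<in> slopes" and Jg: "\<And>i. shifted_energy (g i) = ennreal (a i)" and a0: "\<And>i. a i \<ge> 0"
    and a: "a \<longlonglongrightarrow> \<mu>" and T: "AE x in unit_leb. (\<lambda>i. tail (g i) x) \<longlonglongrightarrow> T x"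
  shows "\<exists>G\<in>slopes. shifted_energy G \<le> ennreal \<mu>"
proof -
  let ?N = "density unit_leb (\<lambda>R. ennreal (R\<^sup>2))"
  have [measurable]: "(\<lambda>R. R) \<in> borel_measurable unit_leb" by (rule borel_measurable_unit_leb) auto
  have gp: "g i R > 0" and gi: "integrable unit_leb (g i)" and gl: "tail (g i) 0 \<le> l" for i R 
    using g[of i] by (auto simp: slopes_def)
  note [measurable] = slopes_measurable(1)[OF g] energy_measurable(3)[OF g]
  obtain B where B: "\<And>i. a i \<le> B" 
    using convergent_imp_Bseq[OF convergentI[OF a]] unfolding Bseq_def real_norm_def abs_le_iff by blast
  have entB: "(LINT R|?N. ent (g i R)) \<le> 2 / (C * (\<gamma> - 1)) * B + 1" for i
  proof -
    have "(LINT R|?N. ent (g i R)) \<le> 2 / (C * (\<gamma> - 1)) * a i + 1" by (rule entropy_bound(2)[OF g Jg a0])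
    also have "\<dots> \<le> 2 / (C * (\<gamma> - 1)) * B + 1"
      using B[of i] C_pos \<gamma>_gt by (intro add_mono mult_left_mono) auto
    finally show ?thesis .
  qed
  obtain c G where c: "\<And>n. c n \<in> tail_weights n" and GN: "integrable ?N G"
    and convN: "AE x in ?N. (\<lambda>n. wsum (c n) (\<lambda>i. g i x)) \<longlonglongrightarrow> G x"
    and L1N: "(\<lambda>n. LINT x|?N. \<bar>wsum (c n) (\<lambda>i. g i x) - G x\<bar>) \<longlonglongrightarrow> 0"
    by (rule convex_combinations_L1_converge[of g ?N, OF _ gp entropy_bound(1)[OF g Jg a0] entB]) auto
  define h where "h n x = wsum (c n) (\<lambda>i. g i x)" for n x
  have hi: "integrable unit_leb (h n)" for n unfolding h_def by (rule integral_wsum(1)[OF gi])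
  have [measurable]: "h n \<in> borel_measurable unit_leb" for n using hi by auto
  have Gm [measurable]: "G \<in> borel_measurable unit_leb"
    using borel_measurable_integrable[OF GN] by simp
  \<comment> \<open>The weight vanishes only at 0, so null sets of the weighted measure are
    null.\<close>
  have conv: "AE x in unit_leb. h' x" if "AE x in ?N. h' x" for h'
  proof -
    have "AE x in unit_leb. 0 < ennreal (x\<^sup>2) \<longrightarrow> h' x" using that by (subst (asm) AE_density) auto
    with AE_unit_leb_in show ?thesis by eventually_elim auto
  qed
  have hG: "AE x in unit_leb. (\<lambda>n. h n x) \<longlonglongrightarrow> G x" using conv[OF convN] by (simp add: h_def)
  have iG2: "integrable unit_leb (\<lambda>R. R\<^sup>2 * G R)"
    using GN by (subst (asm) integrable_density) auto
  have L1: "(\<lambda>n. LINT R|unit_leb. R\<^sup>2 * \<bar>h n R - G R\<bar>) \<longlonglongrightarrow> 0"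
    using L1N by (subst (asm) integral_density) (auto simp: h_def[symmetric])
  note tw = tail_weighted_limit[OF hi iG2 Gm L1]
  have tail_h: "tail (h n) x = wsum (c n) (\<lambda>i. tail (g i) x)" for n x
  proof -
    have "tail (h n) x = (LINT y|unit_leb. wsum (c n) (\<lambda>i. indicator {x..} y * g i y))"
      unfolding tail_def h_def wsum_cmult ..
    also have "\<dots> = wsum (c n) (\<lambda>i. tail (g i) x)"
      unfolding tail_def by (rule integral_wsum(2)) (rule integrable_unit_leb_indicator[OF gi], simp)
    finally show ?thesis .
  qed
  \<comment> \<open>The averaged primitives tend to \<open>T x\<close> because the weights are
    forward, and to \<open>tail G x\<close> by L^1 convergence; this identifies the Helly
    limit.\<close>
  have Tx: "AE x in unit_leb. (\<lambda>i. tail (g i) x) \<longlonglongrightarrow> tail G x"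
    using T AE_unit_leb_in
  proof eventually_elim
    case (elim x)
    have "(\<lambda>n. tail (h n) x) \<longlonglongrightarrow> T x" unfolding tail_h by (rule wsum_tendsto[OF c elim(1)])
    moreover have "(\<lambda>n. tail (h n) x) \<longlonglongrightarrow> tail G x" by (rule tw(2)) (use elim in simp)
    ultimately have "T x = tail G x" by (rule LIMSEQ_unique)
    then show ?case using elim by simp
  qed
  have G0: "AE x in unit_leb. G x \<ge> 0"
    using hG
  proof eventually_elim
    case (elim x)
    show ?case by (rule LIMSEQ_le_const[OF elim]) (use wsum_pos[OF c gp] in \<open>auto simp: h_def less_imp_le\<close>)
  qed
  have tGl: "AE x in unit_leb. tail G x \<le> l"
    using Tx
  proof eventually_elim
    case (elim x)
    have "tail (g i) x \<le> l" for i
      using tail_le_tail_0[OF gi, of i x] gp gl[of i] by (auto simp: less_imp_le intro: order_trans)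
    then show ?case by (intro LIMSEQ_le_const2[OF elim]) auto
  qed
  \<comment> \<open>Tails from points \<open>X n\<close> tending to 0 are at most l, and Fatou
    exhausts the interval. Mass lost at the center only lowers the integral, so r(0) >= 0
    persists.\<close>
  have nnG: "(\<integral>\<^sup>+y. ennreal (G y) \<partial>unit_leb) \<le> ennreal l"
  proof -
    have "\<exists>x. 0 < x \<and> x < inverse (real (Suc n)) \<and> x < 1 \<and> tail G x \<le> l" for n
      by (rule AE_unit_leb_arbitrarily_small[OF tGl]) simp
    then obtain X where X: "\<And>n. 0 < X n" "\<And>n. X n < inverse (real (Suc n))" "\<And>n. tail G (X n) \<le> l" by metis
    have X0: "X \<longlonglongrightarrow> 0"
      by (rule tendsto_sandwich[OF _ _ tendsto_const LIMSEQ_inverse_real_of_nat])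
         (use X in \<open>auto intro!: always_eventually less_imp_le simp del: of_nat_Suc\<close>)
    have "(\<integral>\<^sup>+y. ennreal (G y) \<partial>unit_leb) \<le> (\<integral>\<^sup>+y. liminf (\<lambda>n. ennreal (indicator {X n..} y * G y)) \<partial>unit_leb)"
    proof (rule nn_integral_mono)
      fix y assume "y \<in> space unit_leb"
      then have "\<forall>\<^sub>F n in sequentially. X n < y" using order_tendstoD(2)[OF X0] by auto
      then have "\<forall>\<^sub>F n in sequentially. ennreal (G y) \<le> ennreal (indicator {X n..} y * G y)"
        by eventually_elim auto
      then show "ennreal (G y) \<le> liminf (\<lambda>n. ennreal (indicator {X n..} y * G y))" by (rule Liminf_bounded)
    qed
    also have "\<dots> \<le> liminf (\<lambda>n. \<integral>\<^sup>+y. ennreal (indicator {X n..} y * G y) \<partial>unit_leb)"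
      by (rule nn_integral_liminf) (use tw(1)[OF X(1)] in auto)
    also have "\<dots> \<le> ennreal l"
    proof (rule Liminf_le)
      have "(\<integral>\<^sup>+y. ennreal (indicator {X n..} y * G y) \<partial>unit_leb) \<le> ennreal l" for n
      proof -
        have "(\<integral>\<^sup>+y. ennreal (indicator {X n..} y * G y) \<partial>unit_leb) = ennreal (tail G (X n))"
          unfolding tail_def by (rule nn_integral_eq_integral[OF tw(1)[OF X(1)]])
            (use G0 in \<open>eventually_elim, auto simp: indicator_def\<close>)
        then show ?thesis using X(3)[of n] by (simp add: ennreal_leI)
      qed
      then show "\<forall>\<^sub>F n in sequentially. (\<integral>\<^sup>+y. ennreal (indicator {X n..} y * G y) \<partial>unit_leb) \<le> ennreal l" by simp
    qed simp
    finally show ?thesis .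
  qed
  have iG: "integrable unit_leb G"
    by (rule integrableI_nonneg[OF Gm G0]) (use nnG in \<open>auto intro: order_le_less_trans\<close>)
  have tG0: "tail G 0 \<le> l"
  proof -
    have "ennreal (tail G 0) = (\<integral>\<^sup>+y. ennreal (indicator {0..} y * G y) \<partial>unit_leb)"
      unfolding tail_def by (rule nn_integral_eq_integral[symmetric, OF integrable_unit_leb_indicator[OF iG]])
        (use G0 in \<open>simp, eventually_elim, auto simp: indicator_def\<close>)
    also have "\<dots> = (\<integral>\<^sup>+y. ennreal (G y) \<partial>unit_leb)" by (rule nn_integral_cong) auto
    finally have "ennreal (tail G 0) \<le> ennreal l" using nnG by simp
    then show ?thesis using l_pos by (subst (asm) ennreal_le_iff) auto
  qed

  define W where "W i R = rad (g i) R / R" for i R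
  define \<Psi> where "\<Psi> n R = wsum (c n) (\<lambda>i. integrand R (g i R) (W i R))" for n R
  have Wp: "0 < W i R" "W i R \<le> l / R" if "0 < R" "R < 1" for i R
    using rad_pos[OF g, of R i] rad_le[OF g, of i R] that by (auto simp: W_def intro!: divide_right_mono)
  have Fnn: "integrand R (g i R) (W i R) \<ge> 0" if "0 < R" "R < 1" for i R
    using integrand_lower(2)[OF that gp Wp(1)[OF that]] .
  have iF: "integrable unit_leb (\<lambda>R. integrand R (g i R) (W i R))" and eF: "(LINT R|unit_leb. integrand R (g i R) (W i R)) = a i" for i
  proof -
    have nn: "AE R in unit_leb. 0 \<le> integrand R (g i R) (W i R)" by (rule AE_I2) (use Fnn in auto)
    have int_F: "(\<integral>\<^sup>+R. ennreal (integrand R (g i R) (W i R)) \<partial>unit_leb) = ennreal (a i)"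
      using Jg[of i] by (simp add: shifted_energy_def W_def)
    show "integrable unit_leb (\<lambda>R. integrand R (g i R) (W i R))"
      by (rule integrableI_nonneg[OF _ nn]) (use int_F in \<open>auto simp: W_def\<close>)
    show "(LINT R|unit_leb. integrand R (g i R) (W i R)) = a i"
      by (subst integral_eq_nn_integral[OF _ nn]) (use int_F a0[of i] in \<open>auto simp: W_def\<close>)
  qed
  have i\<Psi>: "integrable unit_leb (\<Psi> n)" "(LINT R|unit_leb. \<Psi> n R) = wsum (c n) a" for n
    unfolding \<Psi>_def using integral_wsum[OF iF, of "c n"] eF by auto
  have [measurable]: "\<Psi> n \<in> borel_measurable unit_leb" for n using i\<Psi>(1) by auto
  have \<Psi>nn: "\<Psi> n R \<ge> 0" if "0 < R" "R < 1" for n R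
    using wsum_mono[OF c, of n "\<lambda>_. 0"] wsum_const[OF c, of n 0] Fnn[OF that] by (simp add: \<Psi>_def)
  \<comment> \<open>By linearity the averaged integrands have integrals \<open>wsum (c n) a\<close>,
    which share the limit of \<open>a\<close>.\<close>
  have fatou: "(\<integral>\<^sup>+R. liminf (\<lambda>n. ennreal (\<Psi> n R)) \<partial>unit_leb) \<le> ennreal \<mu>"
  proof -
    have "(\<integral>\<^sup>+R. liminf (\<lambda>n. ennreal (\<Psi> n R)) \<partial>unit_leb) \<le> liminf (\<lambda>n. \<integral>\<^sup>+R. ennreal (\<Psi> n R) \<partial>unit_leb)"
      by (rule nn_integral_liminf) measurable
    also have "(\<lambda>n. \<integral>\<^sup>+R. ennreal (\<Psi> n R) \<partial>unit_leb) = (\<lambda>n. ennreal (wsum (c n) a))"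
    proof
      fix n
      show "(\<integral>\<^sup>+R. ennreal (\<Psi> n R) \<partial>unit_leb) = ennreal (wsum (c n) a)"
        unfolding i\<Psi>(2)[symmetric] by (rule nn_integral_eq_integral[OF i\<Psi>(1)]) (rule AE_I2, use \<Psi>nn in auto)
    qed
    also have "liminf (\<lambda>n. ennreal (wsum (c n) a)) = ennreal \<mu>"
      by (intro lim_imp_Liminf tendsto_ennrealI wsum_tendsto[OF c a]) simp
    finally show ?thesis .
  qed
  have fin: "AE R in unit_leb. liminf (\<lambda>n. ennreal (\<Psi> n R)) \<noteq> \<infinity>"
  proof (rule nn_integral_PInf_AE)
    show "(\<integral>\<^sup>+R. liminf (\<lambda>n. ennreal (\<Psi> n R)) \<partial>unit_leb) \<noteq> \<infinity>" using fatou by (auto simp: top_unique)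
  qed measurable
  \<comment> \<open>If the averaged slopes tended to 0 at R, the averaged energies would tend to
    infinity there, against the finiteness in \<open>fin\<close>.\<close>
  have Gpos: "AE R in unit_leb. G R > 0"
    using fin hG G0 AE_unit_leb_in
  proof eventually_elim
    case (elim R)
    then have R: "0 < R" "R < 1" by auto
    show ?case
    proof (rule ccontr)
      assume "\<not> 0 < G R"
      then have h0: "(\<lambda>n. wsum (c n) (\<lambda>i. g i R)) \<longlonglongrightarrow> 0" using elim by (simp add: h_def)
      have k: "R\<^sup>2 * K / 2 * (R\<^sup>2 / l\<^sup>2) > 0" using R K_pos l_pos by simp
      have "\<forall>\<^sub>F n in sequentially. A < \<Psi> n R" for A
        unfolding \<Psi>_def
        by (rule averages_blow_up[OF c gp h0 k integrand_blow_up_bound[OF R gp Wp(1,2)[OF R]]])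
      then have "\<forall>\<^sub>F n in sequentially. ennreal A \<le> ennreal (\<Psi> n R)" for A
        by (rule eventually_mono[OF _ ennreal_leI[OF less_imp_le]])
      then have le: "ennreal A \<le> liminf (\<lambda>n. ennreal (\<Psi> n R))" for A by (rule Liminf_bounded)
      obtain q where "liminf (\<lambda>n. ennreal (\<Psi> n R)) = ennreal q" "q \<ge> 0"
        using elim(1) by (cases "liminf (\<lambda>n. ennreal (\<Psi> n R))") auto
      with le[of "q + 1"] show False by simp
    qed
  qed

  \<comment> \<open>Membership in \<open>slopes\<close> asks for positivity everywhere; the null set
    changes neither tails nor energy.\<close>
  define G' where "G' x = (if G x > 0 then G x else 1)" for x
  have [measurable]: "G' \<in> borel_measurable unit_leb" unfolding G'_def[abs_def] by measurable
  have G'G: "AE x in unit_leb. G x = G' x" using Gpos by eventually_elim (simp add: G'_def)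
  have iG': "integrable unit_leb G'" using integrable_cong_AE[OF _ _ G'G] iG by auto
  have tG': "tail G' x = tail G x" for x by (rule tail_cong_AE[OF iG iG' G'G, symmetric])
  have G's: "G' \<in> slopes" using iG' tG0 tG' by (auto simp: slopes_def G'_def)
  have "shifted_energy G' \<le> (\<integral>\<^sup>+R. liminf (\<lambda>n. ennreal (\<Psi> n R)) \<partial>unit_leb)"
    unfolding shifted_energy_def
  proof (rule nn_integral_mono_AE)
    show "AE R in unit_leb. ennreal (integrand R (G' R) (rad G' R / R)) \<le> liminf (\<lambda>n. ennreal (\<Psi> n R))"
      using hG Gpos G'G Tx AE_unit_leb_in
    proof eventually_elim
      case (elim R)
      then have R: "0 < R" "R < 1" by auto
      have w: "rad G' R / R > 0" using rad_pos[OF G's, of R] R by simp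
      have Wlim: "(\<lambda>i. W i R) \<longlonglongrightarrow> rad G' R / R"
        unfolding W_def rad_def tG' by (intro tendsto_intros elim) (use R in auto)
      \<comment> \<open>At fixed R the averaged functions of the slope differ through the transverse
        stretch \<open>W i R\<close>, which converges; this is the situation of
        \<open>convex_averages_lower\<close>.\<close>
      have ev: "\<forall>\<^sub>F n in sequentially. A < \<Psi> n R" if "A < integrand R (G' R) (rad G' R / R)" for A
        unfolding \<Psi>_def
      proof (rule convex_averages_lower[where f="\<lambda>i v. integrand R v (W i R)" and flim="\<lambda>v. integrand R v (rad G' R / R)" and v="G' R"])
        show "(\<lambda>n. wsum (c n) (\<lambda>i. g i R)) \<longlonglongrightarrow> G' R" using elim by (simp add: h_def)
        show "G' R > 0" using elim by simp
        show "convex_on {0<..} (\<lambda>v. integrand R v (W i R))" for i by (rule integrand_convex[OF R Wp(1)[OF R]])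
        show "convex_on {0<..} (\<lambda>v. integrand R v (rad G' R / R))" by (rule integrand_convex[OF R w])
        show "(\<lambda>i. integrand R x (W i R)) \<longlonglongrightarrow> integrand R x (rad G' R / R)" if "x > 0" for x
          by (rule integrand_tendsto[OF R Wlim w that])
        show "A < integrand R (G' R) (rad G' R / R)" by (fact that)
      qed (fact c gp)+
      show ?case
      proof (subst le_Liminf_iff, intro allI impI)
        fix y assume y: "y < ennreal (integrand R (G' R) (rad G' R / R))"
        then obtain A where A: "y = ennreal A" "A \<ge> 0" by (cases y) auto
        then have "A < integrand R (G' R) (rad G' R / R)" using y by (simp add: ennreal_less_iff)
        from ev[OF this] show "\<forall>\<^sub>F n in sequentially. y < ennreal (\<Psi> n R)"
          by eventually_elim (use A in \<open>simp add: ennreal_less_iff\<close>)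
      qed
    qed
  qed
  also have "\<dots> \<le> ennreal \<mu>" by (rule fatou)
  finally show ?thesis using G's by blast
qed

section \<open>Existence of a minimizer\<close>

lemma minimizer_exists:
  assumes ne: "admissible \<Phi> l \<noteq> {}"
  shows "\<exists>r\<in>admissible \<Phi> l. I_total \<Phi> \<rho>0 r = (INF q\<in>admissible \<Phi> l. I_total \<Phi> \<rho>0 q)"
proof -
  \<comment> \<open>Collecting only finite values allows a real infimum; admissibility of some
    deformation makes the set nonempty.\<close>
  define S where "S = {j. j \<ge> 0 \<and> (\<exists>g\<in>slopes. shifted_energy g = ennreal j)}"
  have S: "S \<noteq> {}" 
  proof -
    obtain r where "r \<in> admissible \<Phi> l" using ne by blast
    then show ?thesis by (rule admissible_slope) (auto simp: S_def)
  qed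
  have bdd: "bdd_below S" by (rule bdd_belowI[of _ 0]) (auto simp: S_def)
  define \<mu> where "\<mu> = Inf S"
  have \<mu>: "\<mu> \<le> j" if "j \<in> S" for j unfolding \<mu>_def by (rule cInf_lower[OF that bdd])
  have \<mu>0: "\<mu> \<ge> 0" unfolding \<mu>_def by (rule cInf_greatest[OF S]) (auto simp: S_def)
  have "\<exists>j\<in>S. j < \<mu> + inverse (real (Suc n))" for n
    using cInf_lessD[OF S, of "\<mu> + inverse (real (Suc n))"] unfolding \<mu>_def by auto
  then have "\<exists>g j. g \<in> slopes \<and> j \<ge> 0 \<and> shifted_energy g = ennreal j \<and> j < \<mu> + inverse (real (Suc n))" for n
    unfolding S_def by blast
  then obtain g a where g: "\<And>n. g n \<in> slopes" and a: "\<And>n. a n \<ge> 0" "\<And>n. shifted_energy (g n) = ennreal (a n)" 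
      "\<And>n. a n < \<mu> + inverse (real (Suc n))" by metis
  have aS: "a n \<in> S" for n using g a by (auto simp: S_def)
  have "(\<lambda>n. \<mu> + inverse (real (Suc n))) \<longlonglongrightarrow> \<mu> + 0"
    by (intro tendsto_intros LIMSEQ_inverse_real_of_nat)
  then have lim: "a \<longlonglongrightarrow> \<mu>"
    by (intro tendsto_sandwich[OF _ _ tendsto_const, of \<mu> a])
       (auto intro!: always_eventually \<mu>[OF aS] less_imp_le[OF a(3)] simp del: of_nat_Suc)
  obtain \<sigma> T where \<sigma>: "strict_mono (\<sigma> :: nat \<Rightarrow> nat)" and T: "AE x in unit_leb. (\<lambda>j. tail (g (\<sigma> j)) x) \<longlonglongrightarrow> T x"
    by (rule tail_subsequence[OF g])
  obtain G where G: "G \<in> slopes" "shifted_energy G \<le> ennreal \<mu>"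
    using energy_limit[OF g a(2,1) LIMSEQ_subseq_LIMSEQ[OF lim \<sigma>, unfolded o_def] T] by blast
  obtain j where j: "j \<ge> 0" "shifted_energy G = ennreal j"
    using G(2) by (cases "shifted_energy G") (auto simp: top_unique)
  have j\<mu>: "j \<le> \<mu>" using G(2) j \<mu>0 by simp
  note rG = slope_admissible[OF G(1) j(2,1)]
  have le: "I_total \<Phi> \<rho>0 (rad G) \<le> I_total \<Phi> \<rho>0 q" if q: "q \<in> admissible \<Phi> l" for q
  proof (rule admissible_slope[OF q])
    fix g' j' assume "g' \<in> slopes" "0 \<le> j'" "shifted_energy g' = ennreal j'" and I: "I_total \<Phi> \<rho>0 q = ereal (j' - c0)"
    then have "j' \<in> S" by (auto simp: S_def)
    then show ?thesis unfolding I rG(2) using \<mu> j\<mu> by fastforce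
  qed
  have "I_total \<Phi> \<rho>0 (rad G) = (INF q\<in>admissible \<Phi> l. I_total \<Phi> \<rho>0 q)"
    by (rule antisym) (auto intro: INF_greatest le INF_lower rG(1))
  then show ?thesis using rG(1) by blast
qed

end

theorem theorem3p2:
  fixes \<Phi> :: "real \<Rightarrow> real \<Rightarrow> real \<Rightarrow> real \<Rightarrow> real"
    and \<rho>0 \<phi> h :: "real \<Rightarrow> real"
    and l k0 k1 C \<gamma> K s :: real
  assumes \<Phi>_nonneg: "\<And>R v1 v2 v3. \<lbrakk>0 \<le> R; R \<le> 1; v1 > 0; v2 > 0; v3 > 0\<rbrakk> \<Longrightarrow> \<Phi> R v1 v2 v3 \<ge> 0"
    and \<Phi>_symmetric: "symmetric_in_stretches \<Phi>"
    and \<Phi>_measurable: "\<And>v1 v2 v3. \<lbrakk>v1 > 0; v2 > 0; v3 > 0\<rbrakk> \<Longrightarrow>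
           (\<lambda>R. \<Phi> R v1 v2 v3) \<in> borel_measurable (lebesgue_on {0..1})"
    and \<Phi>_convex: "stretch_convex \<Phi>"
    and \<rho>0_measurable: "\<rho>0 \<in> borel_measurable (lebesgue_on {0..1})"
    and k0_pos: "k0 > 0" and k1_pos: "k1 > 0"
    and \<rho>0_bounds: "\<And>R. \<lbrakk>0 \<le> R; R \<le> 1\<rbrakk> \<Longrightarrow> k0 \<le> \<rho>0 R \<and> \<rho>0 R \<le> k1"
    and l_pos: "l > 0"
    and homogeneous_admissible: "(\<lambda>R. l * R) \<in> admissible \<Phi> l"
    and \<Phi>_lower: "\<And>R v1 v2 v3. \<lbrakk>0 \<le> R; R \<le> 1; v1 > 0; v2 > 0; v3 > 0\<rbrakk> \<Longrightarrow>
           \<Phi> R v1 v2 v3 \<ge> \<phi> v1 + \<phi> v2 + \<phi> v3 + h (v1 * v2 * v3)"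
    and \<phi>_pos: "\<And>v. v > 0 \<Longrightarrow> \<phi> v > 0"
    and h_pos: "\<And>d. d > 0 \<Longrightarrow> h d > 0"
    and \<phi>_convex: "strictly_convex_on {0<..} \<phi>"
    and h_convex: "strictly_convex_on {0<..} h"
    and C_pos: "C > 0" and \<gamma>_range: "1 < \<gamma>" "\<gamma> < 3"
    and \<phi>_growth: "\<And>v. v > 0 \<Longrightarrow> \<phi> v \<ge> C * v powr \<gamma>"
    and h_superlinear: "filterlim (\<lambda>d. h d / d) at_top at_top"
    and K_pos: "K > 0" and s_ge: "s \<ge> \<gamma> / (\<gamma> - 1)"
    and h_growth: "\<And>d. d > 0 \<Longrightarrow> h d \<ge> K * d powr (- s)"
  shows "\<exists>r\<in>admissible \<Phi> l. I_total \<Phi> \<rho>0 r = (INF q\<in>admissible \<Phi> l. I_total \<Phi> \<rho>0 q)"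
proof -
  \<comment> \<open>The contributions of \<open>\<phi>\<close> at the second and third stretch are
    positive, so they may be dropped from the lower bound.\<close>
  have lower: "C * v1 powr \<gamma> + K * (v1 * v2 * v3) powr (- s) \<le> \<Phi> R v1 v2 v3"
    if "0 \<le> R" "R \<le> 1" "v1 > 0" "v2 > 0" "v3 > 0" for R v1 v2 v3
    using \<Phi>_lower[OF that] \<phi>_growth[of v1] \<phi>_pos[of v2] \<phi>_pos[of v3] h_growth[of "v1 * v2 * v3"] that by simp
  have bounds: "0 \<le> \<rho>0 R \<and> \<rho>0 R \<le> k1" if "0 \<le> R" "R \<le> 1" for R
    using \<rho>0_bounds[OF that] k0_pos by simp
  interpret star_energy \<Phi> \<rho>0 l k1 C \<gamma> K s
    by unfold_locales (fact \<Phi>_nonneg \<Phi>_symmetric \<Phi>_measurable \<Phi>_convex \<rho>0_measurable bounds l_pos lower C_pos K_pos \<gamma>_range(1) s_ge)+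
  show ?thesis by (rule minimizer_exists) (use homogeneous_admissible in blast)
qed

end
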